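(* For $n\ge 1$ let $A_n^{\mathrm{maj},\mathrm{exc}}(q,t):=\sum_{\sigma\in\mathfrak S_n}q^{\mathrm{maj}(\sigma)}t^{\mathrm{exc}(\sigma)}$, and let $A_0^{\mathrm{maj},\mathrm{exc}}(q,t)=1$. Then, as formal power series in $z$ with coefficients in $\mathbb Q(q,t)$, $$\sum_{n\ge 0}A_n^{\mathrm{maj},\mathrm{exc}}(q,t)\frac{z^n}{[n]_q!}=\frac{(1-tq)\exp_q(z)}{\exp_q(ztq)-tq\exp_q(z)}.$$
   Context: $\mathfrak S_n$ is the set of permutations of $[n]=\{1,\dots,n\}$. For $\sigma\in\mathfrak S_n$: $\mathrm{DES}(\sigma)=\{i\in[n-1]:\sigma(i)>\sigma(i+1)\}$, $\mathrm{maj}(\sigma)=\sum_{i\in\mathrm{DES}(\sigma)}i$, and $\mathrm{exc}(\sigma)=|\{i\in[n-1]:\sigma(i)>i\}|$. Also $[n]_q=1+q+\dots+q^{n-1}$, $[n]_q!=[n]_q[n-1]_q\cdots[1]_q$ (with $[0]_q!=1$), and $\exp_q(z)=\sum_{n\ge0}\frac{z^n}{[n]_q!}$. Here $q,t,z$ are indeterminates. *)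

theory Defs
  imports
    "HOL-Computational_Algebra.Computational_Algebra"
    "HOL-Combinatorics.Permutations"
begin

definition DES :: "nat \<Rightarrow> (nat \<Rightarrow> nat) \<Rightarrow> nat set" where
  "DES n \<sigma> = {i \<in> {1..n-1}. \<sigma> i > \<sigma> (i + 1)}"

definition maj :: "nat \<Rightarrow> (nat \<Rightarrow> nat) \<Rightarrow> nat" where
  "maj n \<sigma> = (\<Sum>i\<in>DES n \<sigma>. i)"

definition exc :: "nat \<Rightarrow> (nat \<Rightarrow> nat) \<Rightarrow> nat" where
  "exc n \<sigma> = card {i \<in> {1..n-1}. \<sigma> i > i}"

definition A_maj_exc :: "nat \<Rightarrow> 'a::comm_ring_1 \<Rightarrow> 'a \<Rightarrow> 'a" where
  "A_maj_exc n q t =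
     (if n = 0 then 1
      else \<Sum>\<sigma> | \<sigma> permutes {1..n}. q ^ maj n \<sigma> * t ^ exc n \<sigma>)"

definition q_int :: "'a::comm_ring_1 \<Rightarrow> nat \<Rightarrow> 'a" where
  "q_int q n = (\<Sum>i<n. q ^ i)"

definition q_fact :: "'a::comm_ring_1 \<Rightarrow> nat \<Rightarrow> 'a" where
  "q_fact q n = (\<Prod>k=1..n. q_int q k)"

definition q_exp :: "'a::field \<Rightarrow> 'a fps" where
  "q_exp q = Abs_fps (\<lambda>n. 1 / q_fact q n)"

text \<open>The field of rational functions in two indeterminates over the rationals is
  realised as the fraction field of the polynomial ring in the outer indeterminate
  \<open>t\<close> over the polynomial ring in the inner indeterminate \<open>q\<close>.\<close>

type_synonym rat_fun_qt = "rat poly poly fract"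

definition q_var :: rat_fun_qt where
  "q_var = to_fract [:[:0, 1:]:]"

definition t_var :: rat_fun_qt where
  "t_var = to_fract [:0, 1:]"

end

theory Submission
  imports Defs "HOL-Library.Product_Lexorder" "HOL-Library.Poly_Mapping"
begin

text \<open>
  Write \<open>a = tq\<close>. The set \<open>DEX \<sigma>\<close> satisfies \<open>\<Sum>DEX \<sigma> + exc \<sigma> = maj \<sigma>\<close>, and summing \<open>q\<close> to the
  power \<open>s 1 + \<dots> + s n\<close> over the weakly decreasing sequences \<open>s\<close> that descend strictly at \<open>DEX \<sigma>\<close> gives
  \<open>q\<close> to the power \<open>\<Sum>DEX \<sigma>\<close> divided by \<open>(1 - q) \<dots> (1 - q^n)\<close>. Fix \<open>s\<close> instead, with multiset of
  values \<open>M\<close>. The compatible \<open>\<sigma>\<close>, weighted by \<open>a ^ exc \<sigma>\<close>, correspond to words with content \<open>M\<close>, and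
  they are counted by the coefficient of the monomial \<open>M\<close> in a product of linear forms, as in
  MacMahon's master theorem. With \<open>l x = a * (\<Sum>y\<ge>x. y) + (\<Sum>y\<le>x. y)\<close>, the product of the \<open>l x - x\<close>
  equals \<open>a\<close> times the product of the \<open>l x - a * x\<close> by telescoping. Extracting coefficients, the
  generating function \<open>P\<close> of the compatible pairs over finitely many letters satisfies
  \<open>P(z) * (H(az) - a * H(z)) = (1 - a) * H(z)\<close>, where \<open>H(z)\<close> is the product of the
  \<open>1 / (1 - z * q^x)\<close>. For real \<open>0 < q < 1\<close>, letting the number of letters tend to infinity gives the
  theorem, and the resulting identity of polynomials in \<open>q\<close> and \<open>t\<close> holds at infinitely many points.
\<close>

section \<open>Permutations compatible with a weakly decreasing sequence\<close>

text \<open>The descent set of \<open>\<sigma>\<close>, written as a word in which the values at excedances are barred and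
  every barred letter counts as smaller than every unbarred one (Shareshian and Wachs).\<close>

definition DEX :: "nat \<Rightarrow> (nat \<Rightarrow> nat) \<Rightarrow> nat set" where
  "DEX n \<sigma> = {i \<in> {1..n-1}. \<not> i < \<sigma> i \<and> i + 1 < \<sigma> (i + 1) \<or>
     (i < \<sigma> i \<longleftrightarrow> i + 1 < \<sigma> (i + 1)) \<and> \<sigma> i > \<sigma> (i + 1)}"

text \<open>\<open>DEX\<close> and the descent set differ only where exactly one of \<open>i\<close>
  and \<open>i + 1\<close> is an excedance. With \<open>e\<close> the excedance indicator the
  discrepancy is \<open>i * (e i - e (i + 1))\<close>, which sums by parts to the number of
  excedances.\<close>

lemma sum_DEX_plus_exc:
  assumes "\<sigma> permutes {1..n}"
  shows "\<Sum>(DEX n \<sigma>) + exc n \<sigma> = maj n \<sigma>"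
proof -
  define e where "e j = (if j < \<sigma> j then 1 else (0::nat))" for j
  define I where "I = {1..n-1}"
  have inj: "inj \<sigma>" using assms by (rule permutes_inj)
  \<comment> \<open>\<open>n\<close> is never an excedance, so the summation by parts has no
    boundary term.\<close>
  have en: "e n = 0"
    using assms permutes_in_image[OF assms, of n] by (cases "n = 0") (auto simp: e_def permutes_def)
  have maj: "maj n \<sigma> = (\<Sum>i\<in>I. if \<sigma> i > \<sigma> (i+1) then i else 0)"
    unfolding maj_def DES_def I_def by (subst sum.inter_filter) auto
  have dex: "\<Sum>(DEX n \<sigma>) = (\<Sum>i\<in>I. if i \<in> DEX n \<sigma> then i else 0)"
    unfolding I_def by (subst sum.inter_filter[symmetric]) (auto intro!: sum.cong simp: DEX_def)
  have exc: "exc n \<sigma> = (\<Sum>i\<in>I. e i)"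
    unfolding exc_def I_def e_def by (simp add: sum.If_cases Int_def)
  have pointwise: "(if \<sigma> i > \<sigma> (i+1) then i else 0) + i * e (i+1)
      = (if i \<in> DEX n \<sigma> then i else 0) + i * e i" if "i \<in> I" for i
  proof -
    \<comment> \<open>If \<open>i\<close> is an excedance and \<open>i + 1\<close> is not, then
      \<open>\<sigma> (i + 1) \<le> i + 1 \<le> \<sigma> i\<close>; distinctness makes this a
      descent.\<close>
    have "\<sigma> i \<noteq> \<sigma> (i+1)" using inj by (simp add: inj_eq)
    then show ?thesis using that by (auto simp: DEX_def e_def I_def)
  qed
  have shift: "(\<Sum>i\<in>I. i * e (i+1)) + (\<Sum>i\<in>I. e i) = (\<Sum>i\<in>I. i * e i)"
  proof (cases n)
    case (Suc k)
    have "(\<Sum>i\<in>I. i * e (i+1)) = (\<Sum>i=0..k. i * e (i+1))"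
      unfolding I_def Suc using en by (intro sum.mono_neutral_left) auto
    also have "\<dots> = (\<Sum>j=1..n. (j - 1) * e j)"
      unfolding Suc using sum.shift_bounds_cl_Suc_ivl[of "\<lambda>j. (j - 1) * e j" 0 k] by simp
    also have "\<dots> = (\<Sum>j\<in>I. (j - 1) * e j)"
      unfolding I_def Suc using en Suc by simp
    finally show ?thesis
      by (auto simp: sum.distrib[symmetric] I_def e_def intro!: sum.cong)
  qed (simp add: I_def)
  have "(\<Sum>i\<in>I. if \<sigma> i > \<sigma> (i+1) then i else 0) + (\<Sum>i\<in>I. i * e (i+1))
      = (\<Sum>i\<in>I. if i \<in> DEX n \<sigma> then i else 0) + (\<Sum>i\<in>I. i * e i)"
    unfolding sum.distrib[symmetric] using pointwise by (rule sum.cong[OF refl])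
  with shift maj dex exc show ?thesis by linarith
qed

section \<open>Sorting permutations\<close>

lemma sorted_map_upt_mono_on:
  fixes f :: "nat \<Rightarrow> 'a::linorder"
  assumes "mono_on {1..n} f"
  shows "sorted (map f [1..<Suc n])"
  using assms by (auto simp: sorted_iff_nth_mono monotone_on_def simp del: upt_Suc)

text \<open>A multiset has only one sorted arrangement.\<close>

lemma mono_on_eq_if_image_mset_eq:
  fixes f g :: "nat \<Rightarrow> 'a::linorder"
  assumes "mono_on {1..n} f" "mono_on {1..n} g"
    and "image_mset f (mset_set {1..n}) = image_mset g (mset_set {1..n})"
    and "i \<in> {1..n}"
  shows "f i = g i"
proof -
  have *: "mset_set {1..n} = mset [1..<Suc n]"
    by (metis atLeastLessThanSuc_atLeastAtMost mset_upt)
  have "mset (map f [1..<Suc n]) = mset (map g [1..<Suc n])"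
    using assms(3) unfolding * mset_map .
  then have "map f [1..<Suc n] = map g [1..<Suc n]"
    by (metis assms(1,2) properties_for_sort sorted_map_upt_mono_on)
  then show ?thesis using assms(4) by (auto simp del: upt_Suc)
qed

lemma ex_sorting_permutation:
  fixes f :: "nat \<Rightarrow> 'a::linorder"
  assumes "inj_on f {1..n}"
  shows "\<exists>\<sigma>. \<sigma> permutes {1..n} \<and> strict_mono_on {1..n} (f \<circ> \<sigma>)"
proof -
  define xs where "xs = sorted_list_of_set (f ` {1..n})"
  have len: "length xs = n" using assms by (simp add: xs_def card_image)
  have set: "set xs = f ` {1..n}" by (simp add: xs_def)
  have sd: "sorted_wrt (<) xs" by (simp add: xs_def)
  define g where "g = the_inv_into {1..n} f"
  \<comment> \<open>The position at which \<open>f\<close> takes its \<open>i\<close>-th smallest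
    value; list indices start at 0.\<close>
  define \<sigma> where "\<sigma> i = (if i \<in> {1..n} then g (xs ! (i - 1)) else i)" for i
  have nth: "xs ! (i - 1) \<in> f ` {1..n}" if "i \<in> {1..n}" for i
    using that nth_mem[of "i - 1" xs] unfolding set[symmetric] len by auto
  have f\<sigma>: "f (\<sigma> i) = xs ! (i - 1)" if "i \<in> {1..n}" for i
    using that nth[OF that] assms by (simp add: \<sigma>_def g_def f_the_inv_into_f)
  have sm: "strict_mono_on {1..n} (f \<circ> \<sigma>)"
  proof (rule strict_mono_onI)
    fix i j assume ij: "i \<in> {1..n}" "j \<in> {1..n}" "i < j"
    then have "xs ! (i - 1) < xs ! (j - 1)"
      using sd len by (intro sorted_wrt_nth_less[of "(<)"]) auto
    then show "(f \<circ> \<sigma>) i < (f \<circ> \<sigma>) j" using ij by (simp add: f\<sigma>)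
  qed
  have mem: "\<sigma> i \<in> {1..n}" if "i \<in> {1..n}" for i
    using the_inv_into_into[OF assms nth[OF that] subset_refl] that unfolding \<sigma>_def g_def by auto
  have "inj_on \<sigma> {1..n}"
    by (rule inj_on_imageI2[of f]) (use sm strict_mono_on_imp_inj_on in blast)
  then have "bij_betw \<sigma> {1..n} {1..n}"
    using mem unfolding bij_betw_def by (intro conjI endo_inj_surj image_subsetI) auto
  then have "\<sigma> permutes {1..n}"
    by (rule bij_imp_permutes) (auto simp: \<sigma>_def)
  with sm show ?thesis by blast
qed

text \<open>\<open>f \<circ> \<sigma>\<close> and \<open>f \<circ> \<tau>\<close> list the same
  values in increasing order, hence agree, and injectivity cancels \<open>f\<close>.\<close>

lemma sorting_permutation_unique:
  fixes f :: "nat \<Rightarrow> 'a::linorder"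
  assumes inj: "inj_on f {1..n}"
    and \<sigma>: "\<sigma> permutes {1..n}" "strict_mono_on {1..n} (f \<circ> \<sigma>)"
    and \<tau>: "\<tau> permutes {1..n}" "strict_mono_on {1..n} (f \<circ> \<tau>)"
  shows "\<sigma> = \<tau>"
proof
  fix i
  have im: "image_mset (f \<circ> \<rho>) (mset_set {1..n}) = image_mset f (mset_set {1..n})"
    if "\<rho> permutes {1..n}" for \<rho>
    using that by (simp flip: multiset.map_comp add: image_mset_mset_set permutes_inj_on permutes_image)
  show "\<sigma> i = \<tau> i"
  proof (cases "i \<in> {1..n}")
    case True
    then have "(f \<circ> \<sigma>) i = (f \<circ> \<tau>) i"
      using im[OF \<sigma>(1)] im[OF \<tau>(1)]
      by (intro mono_on_eq_if_image_mset_eq[OF strict_mono_on_imp_mono_on[OF \<sigma>(2)]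
            strict_mono_on_imp_mono_on[OF \<tau>(2)]]) simp_all
    then show ?thesis
      using True inj permutes_in_image[OF \<sigma>(1)] permutes_in_image[OF \<tau>(1)] by (auto dest: inj_onD)
  next
    case False
    then show ?thesis using \<sigma>(1) \<tau>(1) by (metis permutes_not_in)
  qed
qed

section \<open>Standardisation between compatible permutations and words\<close>

definition block_starts :: "nat \<Rightarrow> (nat \<Rightarrow> nat) \<Rightarrow> nat set" where
  "block_starts n s = {j \<in> {1..n}. \<forall>i\<in>{1..<j}. s i \<noteq> s j}"

definition compatible_perms :: "nat \<Rightarrow> (nat \<Rightarrow> nat) \<Rightarrow> (nat \<Rightarrow> nat) set" where
  "compatible_perms n s = {\<sigma>. \<sigma> permutes {1..n} \<and> (\<forall>i\<in>DEX n \<sigma>. s i \<noteq> s (i + 1))}"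

text \<open>The letter at position \<open>\<sigma> i\<close> of the word of \<open>\<sigma>\<close> records \<open>s i\<close> and whether \<open>i\<close> is an excedance.
  The last condition excludes the barred fixed points: the bounds on the letters alone only
  give \<open>\<sigma> i \<ge> i\<close> at barred positions.\<close>

definition exc_words :: "nat \<Rightarrow> (nat \<Rightarrow> nat) \<Rightarrow> (nat \<Rightarrow> nat \<times> bool) set" where
  "exc_words n s = {v \<in> {1..n} \<rightarrow>\<^sub>E s ` {1..n} \<times> UNIV.
     image_mset (\<lambda>j. fst (v j)) (mset_set {1..n}) = image_mset s (mset_set {1..n}) \<and>
     (\<forall>j\<in>{1..n}. if snd (v j) then s j \<le> fst (v j) else fst (v j) \<le> s j) \<and>
     (\<forall>j\<in>block_starts n s. v j \<noteq> (s j, True))}"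

definition word_of_perm :: "nat \<Rightarrow> (nat \<Rightarrow> nat) \<Rightarrow> (nat \<Rightarrow> nat) \<Rightarrow> nat \<Rightarrow> nat \<times> bool" where
  "word_of_perm n s \<sigma> = (\<lambda>j\<in>{1..n}. (s (inv \<sigma> j), inv \<sigma> j < j))"

text \<open>Sorting the positions by this key (standardisation) recovers \<open>\<sigma>\<close> from its word.\<close>

definition word_key :: "(nat \<Rightarrow> nat \<times> bool) \<Rightarrow> nat \<Rightarrow> int \<times> bool \<times> nat" where
  "word_key v j = (- int (fst (v j)), \<not> snd (v j), j)"

lemma inj_on_word_key: "inj_on (word_key v) A"
  by (rule inj_onI) (simp add: word_key_def)

lemma word_of_perm_apply:
  assumes "\<sigma> permutes {1..n}" "i \<in> {1..n}"
  shows "word_of_perm n s \<sigma> (\<sigma> i) = (s i, i < \<sigma> i)"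
  using assms permutes_in_image[OF assms(1), of i] permutes_inverses(2)[OF assms(1), of i]
  by (simp add: word_of_perm_def)

lemma strict_mono_on_interval_stepI:
  fixes f :: "nat \<Rightarrow> 'a::linorder"
  assumes "\<And>i. 1 \<le> i \<Longrightarrow> i < n \<Longrightarrow> f i < f (Suc i)"
  shows "strict_mono_on {1..n} f"
proof (rule strict_mono_onI)
  fix i j assume ij: "i \<in> {1..n}" "j \<in> {1..n}" "i < j"
  have "Suc i \<le> k \<Longrightarrow> k \<le> n \<Longrightarrow> f i < f k" for k
  proof (induction k rule: dec_induct)
    case base
    then show ?case using assms ij by auto
  next
    case (step k)
    then show ?case using assms[of k] ij by (metis Suc_leD Suc_le_lessD atLeastAtMost_iff le_trans order.strict_trans less_imp_le)
  qed
  then show "f i < f j" using ij by auto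
qed

text \<open>The key orders by decreasing value, then barred before unbarred, then by position. From
  \<open>i\<close> to \<open>i + 1\<close> either \<open>s\<close> drops, or the values tie; then
  \<open>i \<notin> DEX n \<sigma>\<close> forbids unbarred before barred and forces increasing
  positions between equal bars.\<close>

lemma strict_mono_on_word_key:
  assumes s: "antimono_on {1..n} s" and \<sigma>: "\<sigma> \<in> compatible_perms n s"
  shows "strict_mono_on {1..n} (word_key (word_of_perm n s \<sigma>) \<circ> \<sigma>)"
proof (rule strict_mono_on_interval_stepI)
  fix i assume i: "1 \<le> i" "i < n"
  have p: "\<sigma> permutes {1..n}" using \<sigma> by (simp add: compatible_perms_def)
  have le: "s (Suc i) \<le> s i" using s i by (auto simp: monotone_on_def)
  have ne: "\<sigma> i \<noteq> \<sigma> (Suc i)" using permutes_inj[OF p] by (simp add: inj_eq)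
  have nd: "s i = s (Suc i) \<Longrightarrow> i \<notin> DEX n \<sigma>" using \<sigma> by (auto simp: compatible_perms_def)
  show "(word_key (word_of_perm n s \<sigma>) \<circ> \<sigma>) i < (word_key (word_of_perm n s \<sigma>) \<circ> \<sigma>) (Suc i)"
    using i le nd ne by (auto simp: word_key_def word_of_perm_apply[OF p] DEX_def)
qed

lemma word_of_perm_in_exc_words:
  assumes s: "antimono_on {1..n} s" and \<sigma>: "\<sigma> \<in> compatible_perms n s"
  shows "word_of_perm n s \<sigma> \<in> exc_words n s"
proof -
  define v where "v = word_of_perm n s \<sigma>"
  have p: "\<sigma> permutes {1..n}" using \<sigma> by (simp add: compatible_perms_def)
  have ex: "\<exists>i\<in>{1..n}. j = \<sigma> i" if "j \<in> {1..n}" for j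
    using that permutes_image[OF p] by blast
  have v: "v (\<sigma> i) = (s i, i < \<sigma> i)" "\<sigma> i \<in> {1..n}" if "i \<in> {1..n}" for i
    using word_of_perm_apply[OF p that] permutes_in_image[OF p] that unfolding v_def by auto
  have "v \<in> {1..n} \<rightarrow>\<^sub>E s ` {1..n} \<times> UNIV"
    using ex v by (auto simp: v_def word_of_perm_def PiE_def)
       (metis atLeastAtMost_iff image_eqI inv_f_f p permutes_inj One_nat_def)
  moreover have "image_mset (\<lambda>j. fst (v j)) (mset_set {1..n}) = image_mset s (mset_set {1..n})"
  proof -
    have "image_mset s (mset_set {1..n}) = image_mset ((\<lambda>j. fst (v j)) \<circ> \<sigma>) (mset_set {1..n})"
      by (rule image_mset_cong) (simp add: v)
    also have "\<dots> = image_mset (\<lambda>j. fst (v j)) (mset_set {1..n})"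
      using p by (simp flip: multiset.map_comp add: image_mset_mset_set permutes_inj_on permutes_image)
    finally show ?thesis by simp
  qed
  moreover have "if snd (v j) then s j \<le> fst (v j) else fst (v j) \<le> s j" if j: "j \<in> {1..n}" for j
  proof -
    obtain i where i: "i \<in> {1..n}" "j = \<sigma> i" using ex[OF j] by blast
    then show ?thesis using j s v[OF i(1)] by (auto simp: monotone_on_def)
  qed
  moreover have "v j \<noteq> (s j, True)" if j: "j \<in> block_starts n s" for j
  proof
    assume vj: "v j = (s j, True)"
    obtain i where i: "i \<in> {1..n}" "j = \<sigma> i" using ex[of j] j unfolding block_starts_def by blast
    \<comment> \<open>The bar gives \<open>i < j\<close>, while \<open>s i = s j\<close> contradicts
      that \<open>j\<close> is the first occurrence of its value.\<close>
    then show False using vj v[OF i(1)] j by (auto simp: block_starts_def)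
  qed
  ultimately show ?thesis unfolding exc_words_def v_def[symmetric] by blast
qed

text \<open>The candidate sorts the positions by the key. The main point is that the bars mark
  exactly its excedances, which is shown block by block of \<open>s\<close>.\<close>

lemma exc_words_imp_word_of_perm:
  assumes s: "antimono_on {1..n} s" and v: "v \<in> exc_words n s"
  shows "\<exists>\<sigma>\<in>compatible_perms n s. word_of_perm n s \<sigma> = v"
proof -
  obtain \<sigma> where p: "\<sigma> permutes {1..n}" and sm: "strict_mono_on {1..n} (word_key v \<circ> \<sigma>)"
    using ex_sorting_permutation[OF inj_on_word_key] by blast
  have mem: "\<sigma> i \<in> {1..n}" if "i \<in> {1..n}" for i using that permutes_in_image[OF p] by blast
  define b where "b i = snd (v (\<sigma> i))" for i
  have fst_v: "fst (v (\<sigma> i)) = s i" if i: "i \<in> {1..n}" for i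
  proof -
    \<comment> \<open>Negation turns both weakly decreasing sequences into increasing ones with the
      same multiset of values.\<close>
    have "- int (fst (v (\<sigma> i))) = - int (s i)"
    proof (rule mono_on_eq_if_image_mset_eq[OF _ _ _ i])
      have "word_key v (\<sigma> i) \<le> word_key v (\<sigma> j)" if "i \<in> {1..n}" "j \<in> {1..n}" "i \<le> j" for i j
        using strict_mono_on_imp_mono_on[OF sm] that by (auto simp: monotone_on_def)
      then show "mono_on {1..n} (\<lambda>i. - int (fst (v (\<sigma> i))))"
        by (intro monotone_onI) (fastforce simp: word_key_def)
      show "mono_on {1..n} (\<lambda>i. - int (s i))" using s by (auto simp: monotone_on_def)
      have "image_mset (\<lambda>i. - int (fst (v (\<sigma> i)))) (mset_set {1..n}) =
        image_mset (\<lambda>x. - int x) (image_mset (\<lambda>j. fst (v j)) (image_mset \<sigma> (mset_set {1..n})))"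
        by (simp add: multiset.map_comp o_def)
      also have "image_mset \<sigma> (mset_set {1..n}) = mset_set {1..n}"
        using p by (simp add: image_mset_mset_set permutes_inj_on permutes_image)
      also have "image_mset (\<lambda>j. fst (v j)) (mset_set {1..n}) = image_mset s (mset_set {1..n})"
        using v by (simp add: exc_words_def)
      finally show "image_mset (\<lambda>i. - int (fst (v (\<sigma> i)))) (mset_set {1..n}) =
         image_mset (\<lambda>i. - int (s i)) (mset_set {1..n})"
        by (simp add: multiset.map_comp o_def)
    qed
    then show ?thesis by simp
  qed
  have step: "(b (Suc i) \<longrightarrow> b i) \<and> (b i = b (Suc i) \<longrightarrow> \<sigma> i < \<sigma> (Suc i))"
    if i: "1 \<le> i" "i < n" "s i = s (Suc i)" for i
  proof -
    have "word_key v (\<sigma> i) < word_key v (\<sigma> (Suc i))"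
      using strict_mono_onD[OF sm, of i "Suc i"] i by auto
    then show ?thesis using i fst_v[of i] fst_v[of "Suc i"] by (auto simp: word_key_def b_def)
  qed
  have rel: "if b i then s (\<sigma> i) \<le> s i else s i \<le> s (\<sigma> i)" if i: "i \<in> {1..n}" for i
  proof -
    have "if snd (v (\<sigma> i)) then s (\<sigma> i) \<le> fst (v (\<sigma> i)) else fst (v (\<sigma> i)) \<le> s (\<sigma> i)"
      using v mem[OF i] unfolding exc_words_def by blast
    then show ?thesis using fst_v[OF i] by (auto simp: b_def split: if_splits)
  qed
  \<comment> \<open>Upward induction. Inside a block the predecessor is barred too, and positions
    increase. At a block start, earlier positions have values too large for a barred letter, and the
    last condition of \<open>exc_words\<close> excludes the fixed point.\<close>
  have barred: "b i \<Longrightarrow> i < \<sigma> i" if "1 \<le> i" "i \<le> n" for i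
    using that
  proof (induction i rule: dec_induct)
    case base
    have "1 \<in> block_starts n s" using base by (auto simp: block_starts_def)
    then have "v 1 \<noteq> (s 1, True)" using v by (simp add: exc_words_def)
    then have "\<sigma> 1 \<noteq> 1" using base fst_v[of 1] by (cases "v 1") (auto simp: b_def)
    with mem[of 1] base show ?case by auto
  next
    case (step i)
    show ?case
    proof (cases "s i = s (Suc i)")
      case True
      then show ?thesis using step \<open>\<And>i. 1 \<le> i \<Longrightarrow> i < n \<Longrightarrow> s i = s (Suc i) \<Longrightarrow> _\<close>[of i] by auto
    next
      case False
      have lt: "s (Suc i) < s i'" if "i' \<in> {1..i}" for i'
      proof -
        have "s (Suc i) \<le> s i" "s i \<le> s i'" using s that step by (auto simp: monotone_on_def)
        then show ?thesis using False by simp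
      qed
      have "Suc i \<in> block_starts n s" using lt step by (fastforce simp: block_starts_def)
      then have "v (Suc i) \<noteq> (s (Suc i), True)" using v by (simp add: exc_words_def)
      then have "\<sigma> (Suc i) \<noteq> Suc i" using step fst_v[of "Suc i"] by (cases "v (Suc i)") (auto simp: b_def)
      moreover have "\<not> \<sigma> (Suc i) \<le> i"
        using lt[of "\<sigma> (Suc i)"] rel[of "Suc i"] mem[of "Suc i"] step by auto
      ultimately show ?thesis by simp
    qed
  qed
  \<comment> \<open>Dually, downward from \<open>n\<close>: inside a block the successor is unbarred
    too, and at a block end all later positions have values too small for an unbarred
    letter.\<close>
  have unbarred: "\<not> b i \<Longrightarrow> \<sigma> i \<le> i" if "1 \<le> i" "i \<le> n" for i
    using that(2,1)
  proof (induction i rule: inc_induct)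
    case base
    then show ?case using mem[of n] by auto
  next
    case (step i)
    show ?case
    proof (cases "s i = s (Suc i)")
      case True
      then show ?thesis using step \<open>\<And>i. 1 \<le> i \<Longrightarrow> i < n \<Longrightarrow> s i = s (Suc i) \<Longrightarrow> _\<close>[of i] by auto
    next
      case False
      have "s i' < s i" if "i' \<in> {Suc i..n}" for i'
      proof -
        have "s (Suc i) \<le> s i" "s i' \<le> s (Suc i)" using s that step by (auto simp: monotone_on_def)
        then show ?thesis using False by simp
      qed
      from this[of "\<sigma> i"] show ?thesis using rel[of i] mem[of i] step by force
    qed
  qed
  have b_iff: "b i \<longleftrightarrow> i < \<sigma> i" if "i \<in> {1..n}" for i
    using barred[of i] unbarred[of i] that by force
  have "\<sigma> \<in> compatible_perms n s"
    unfolding compatible_perms_def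
  proof (intro CollectI conjI ballI p notI)
    fix i assume i: "i \<in> DEX n \<sigma>" "s i = s (i + 1)"
    then have "1 \<le> i" "i < n" by (auto simp: DEX_def)
    then show False using i step[of i] b_iff[of i] b_iff[of "Suc i"] by (auto simp: DEX_def)
  qed
  moreover have "word_of_perm n s \<sigma> = v"
  proof
    fix j
    show "word_of_perm n s \<sigma> j = v j"
    proof (cases "j \<in> {1..n}")
      case True
      then obtain i where i: "i \<in> {1..n}" "j = \<sigma> i" using permutes_image[OF p] by blast
      then show ?thesis
        using fst_v[OF i(1)] b_iff[OF i(1)] unfolding i(2) word_of_perm_apply[OF p i(1)] b_def
        by (cases "v (\<sigma> i)") auto
    next
      case False
      moreover have "v j = undefined" using v False by (auto simp: exc_words_def PiE_def extensional_def)
      ultimately show ?thesis unfolding word_of_perm_def by auto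
    qed
  qed
  ultimately show ?thesis by blast
qed

lemma card_barred_word_of_perm:
  assumes "\<sigma> permutes {1..n}"
  shows "card {j \<in> {1..n}. snd (word_of_perm n s \<sigma> j)} = exc n \<sigma>"
proof -
  have "bij_betw \<sigma> {i \<in> {1..n-1}. i < \<sigma> i} {j \<in> {1..n}. snd (word_of_perm n s \<sigma> j)}"
  proof (rule bij_betw_imageI)
    show "inj_on \<sigma> {i \<in> {1..n-1}. i < \<sigma> i}" by (rule permutes_inj_on[OF assms])
    show "\<sigma> ` {i \<in> {1..n-1}. i < \<sigma> i} = {j \<in> {1..n}. snd (word_of_perm n s \<sigma> j)}"
    proof (intro equalityI subsetI)
      fix j assume "j \<in> \<sigma> ` {i \<in> {1..n-1}. i < \<sigma> i}"
      then obtain i where i: "j = \<sigma> i" "i \<in> {1..n-1}" "i < \<sigma> i" by blast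
      then have "i \<in> {1..n}" by auto
      then show "j \<in> {j \<in> {1..n}. snd (word_of_perm n s \<sigma> j)}"
        using i permutes_in_image[OF assms, of i] by (simp add: word_of_perm_apply[OF assms])
    next
      fix j assume j: "j \<in> {j \<in> {1..n}. snd (word_of_perm n s \<sigma> j)}"
      then have "j \<in> \<sigma> ` {1..n}" using permutes_image[OF assms] by blast
      then obtain i where i: "j = \<sigma> i" "i \<in> {1..n}" by blast
      then have "i < \<sigma> i" using j by (simp add: word_of_perm_apply[OF assms])
      moreover have "\<sigma> i \<le> n" using j i by simp
      ultimately show "j \<in> \<sigma> ` {i \<in> {1..n-1}. i < \<sigma> i}"
        using i by (intro image_eqI[of _ _ i]) auto
    qed
  qed
  then show ?thesis unfolding exc_def by (rule bij_betw_same_card[symmetric])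
qed

text \<open>The word determines the key, and a key has only one sorting permutation, so
  \<open>word_of_perm\<close> is a bijection; it turns excedances into bars.\<close>

lemma sum_compatible_perms:
  assumes s: "antimono_on {1..n} s"
  shows "(\<Sum>\<sigma>\<in>compatible_perms n s. a ^ exc n \<sigma>) =
    (\<Sum>v\<in>exc_words n s. a ^ card {j \<in> {1..n}. snd (v j)} :: 'a::comm_ring_1)"
proof -
  have "inj_on (word_of_perm n s) (compatible_perms n s)"
  proof (rule inj_onI)
    fix \<sigma> \<tau> assume *: "\<sigma> \<in> compatible_perms n s" "\<tau> \<in> compatible_perms n s"
      "word_of_perm n s \<sigma> = word_of_perm n s \<tau>"
    show "\<sigma> = \<tau>"
      using strict_mono_on_word_key[OF s *(1)] strict_mono_on_word_key[OF s *(2)] * 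
      by (intro sorting_permutation_unique[OF inj_on_word_key[of "word_of_perm n s \<sigma>"]])
        (auto simp: compatible_perms_def)
  qed
  moreover have "word_of_perm n s ` compatible_perms n s = exc_words n s"
    using word_of_perm_in_exc_words[OF s] exc_words_imp_word_of_perm[OF s] by blast
  ultimately have "bij_betw (word_of_perm n s) (compatible_perms n s) (exc_words n s)"
    by (simp add: bij_betw_def)
  from sum.reindex_bij_betw[OF this, of "\<lambda>v. a ^ card {j \<in> {1..n}. snd (v j)}"]
  have "(\<Sum>v\<in>exc_words n s. a ^ card {j \<in> {1..n}. snd (v j)}) =
     (\<Sum>\<sigma>\<in>compatible_perms n s. a ^ card {j \<in> {1..n}. snd (word_of_perm n s \<sigma> j)})" by simp
  also have "\<dots> = (\<Sum>\<sigma>\<in>compatible_perms n s. a ^ exc n \<sigma>)"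
    by (rule sum.cong[OF refl], subst card_barred_word_of_perm) (auto simp: compatible_perms_def)
  finally show ?thesis by simp
qed

section \<open>The generating polynomial of excedance words\<close>

lemma sum_single_mset: "finite J \<Longrightarrow> (\<Sum>j\<in>J. {#f j#}) = image_mset f (mset_set J)"
  by (induction J rule: finite_induct) auto

lemma prod_poly_mapping_single:
  "finite J \<Longrightarrow> (\<Prod>j\<in>J. Poly_Mapping.single (f j) (c j :: 'a::comm_ring_1)) =
     Poly_Mapping.single (\<Sum>j\<in>J. f j :: 'b::comm_monoid_add) (\<Prod>j\<in>J. c j)"
  by (induction J rule: finite_induct) (auto simp: mult_single)

lemma poly_mapping_sum_monomials:
  "(\<Sum>k\<in>Poly_Mapping.keys G. Poly_Mapping.single k (Poly_Mapping.lookup G k)) = G"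
  by (rule poly_mapping_eqI) (auto simp: lookup_sum lookup_single when_def in_keys_iff)

lemma lookup_single_times:
  fixes G :: "'b multiset \<Rightarrow>\<^sub>0 'a::comm_ring_1"
  assumes "S \<subseteq># M"
  shows "Poly_Mapping.lookup (Poly_Mapping.single S c * G) M = c * Poly_Mapping.lookup G (M - S)"
proof -
  have eq: "S + k = M \<longleftrightarrow> k = M - S" for k
    using assms by auto
  have "Poly_Mapping.single S c * G =
      (\<Sum>k\<in>Poly_Mapping.keys G. Poly_Mapping.single (S + k) (c * Poly_Mapping.lookup G k))"
    by (subst poly_mapping_sum_monomials[of G, symmetric]) (simp add: sum_distrib_left mult_single)
  then have "Poly_Mapping.lookup (Poly_Mapping.single S c * G) M =
      (\<Sum>k\<in>Poly_Mapping.keys G. if k = M - S then c * Poly_Mapping.lookup G k else 0)"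
    by (simp add: lookup_sum lookup_single eq when_def)
  also have "\<dots> = c * Poly_Mapping.lookup G (M - S)"
    by (simp add: in_keys_iff)
  finally show ?thesis .
qed

text \<open>Expanding the product chooses one letter per factor, that is, a word \<open>v\<close>;
  the coefficient at \<open>M\<close> collects the words with content \<open>M\<close>.\<close>

lemma lookup_prod_linear_forms:
  fixes w :: "'i \<Rightarrow> 'c \<Rightarrow> 'a::comm_ring_1" and g :: "'c \<Rightarrow> 'b"
  assumes "finite J" "finite B"
  shows "Poly_Mapping.lookup (\<Prod>j\<in>J. \<Sum>y\<in>B. Poly_Mapping.single {#g y#} (w j y)) M =
    (\<Sum>v | v \<in> J \<rightarrow>\<^sub>E B \<and> image_mset (\<lambda>j. g (v j)) (mset_set J) = M. \<Prod>j\<in>J. w j (v j))"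
proof -
  have fin: "finite (J \<rightarrow>\<^sub>E B)" using assms by (intro finite_PiE) auto
  have "(\<Prod>j\<in>J. \<Sum>y\<in>B. Poly_Mapping.single {#g y#} (w j y)) =
      (\<Sum>v\<in>J \<rightarrow>\<^sub>E B. \<Prod>j\<in>J. Poly_Mapping.single {#g (v j)#} (w j (v j)))"
    using assms by (intro prod_sum_PiE)
  also have "\<dots> = (\<Sum>v\<in>J \<rightarrow>\<^sub>E B.
      Poly_Mapping.single (image_mset (\<lambda>j. g (v j)) (mset_set J)) (\<Prod>j\<in>J. w j (v j)))"
    using assms(1) by (simp only: prod_poly_mapping_single sum_single_mset)
  finally have "Poly_Mapping.lookup (\<Prod>j\<in>J. \<Sum>y\<in>B. Poly_Mapping.single {#g y#} (w j y)) M =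
      (\<Sum>v\<in>J \<rightarrow>\<^sub>E B. if image_mset (\<lambda>j. g (v j)) (mset_set J) = M then \<Prod>j\<in>J. w j (v j) else 0)"
    by (simp only: lookup_sum lookup_single when_def)
  also have "\<dots> = (\<Sum>v | v \<in> J \<rightarrow>\<^sub>E B \<and> image_mset (\<lambda>j. g (v j)) (mset_set J) = M. \<Prod>j\<in>J. w j (v j))"
    using fin by (rule sum.inter_filter[symmetric])
  finally show ?thesis .
qed

text \<open>For \<open>x < x'\<close> consecutive in \<open>A\<close>, the factor of \<open>x'\<close> in the first product is the factor of \<open>x\<close>
  in the second one, so the products differ only in one extremal factor each; \<open>r\<close> makes the
  induction on the maximum of \<open>A\<close> work.\<close>

lemma telescoping_products:
  fixes f :: "'b::linorder \<Rightarrow> 'a::comm_ring_1"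
  assumes "finite A" "A \<noteq> {}"
  shows "\<exists>C. (\<Prod>x\<in>A. r + (\<Sum>y\<in>A. if x \<le> y then t * f y else f y)) = (t * sum f A + r) * C \<and>
    (\<Prod>x\<in>A. r + (\<Sum>y\<in>A. if x < y then t * f y else f y)) = (sum f A + r) * C"
  using assms
proof (induction A arbitrary: r rule: finite_linorder_max_induct)
  case (insert z A)
  show ?case
  proof (cases "A = {}")
    case True
    then show ?thesis by (intro exI[of _ 1]) (auto simp: algebra_simps)
  next
    case False
    obtain C where C:
      "(\<Prod>x\<in>A. (r + t * f z) + (\<Sum>y\<in>A. if x \<le> y then t * f y else f y)) = (t * sum f A + (r + t * f z)) * C"
      "(\<Prod>x\<in>A. (r + t * f z) + (\<Sum>y\<in>A. if x < y then t * f y else f y)) = (sum f A + (r + t * f z)) * C"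
      using insert.IH[OF False, of "r + t * f z"] by blast
    have z: "z \<notin> A" using insert.hyps by auto
    have top: "(\<Sum>y\<in>A. if z \<le> y then t * f y else f y) = sum f A"
      "(\<Sum>y\<in>A. if z < y then t * f y else f y) = sum f A"
      using insert.hyps by (intro sum.cong refl if_not_P; force)+
    have 1: "(\<Prod>x\<in>A. r + (\<Sum>y\<in>insert z A. if x \<le> y then t * f y else f y)) =
        (\<Prod>x\<in>A. (r + t * f z) + (\<Sum>y\<in>A. if x \<le> y then t * f y else f y))"
      using insert.hyps z by (intro prod.cong) (auto simp: algebra_simps)
    have 2: "(\<Prod>x\<in>A. r + (\<Sum>y\<in>insert z A. if x < y then t * f y else f y)) =
        (\<Prod>x\<in>A. (r + t * f z) + (\<Sum>y\<in>A. if x < y then t * f y else f y))"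
      using insert.hyps z by (intro prod.cong) (auto simp: algebra_simps)
    have 3: "(\<Sum>y\<in>insert z A. if z \<le> y then t * f y else f y) = t * f z + sum f A"
      "(\<Sum>y\<in>insert z A. if z < y then t * f y else f y) = f z + sum f A"
      "sum f (insert z A) = f z + sum f A"
      using insert.hyps(1) z by (simp_all add: top)
    show ?thesis
      unfolding prod.insert[OF insert.hyps(1) z] 1 2 C 3
      by (intro exI[of _ "(sum f A + (r + t * f z)) * C"]) (simp add: algebra_simps)
  qed
qed simp

section \<open>Linear forms and alternating sums of their coefficients\<close>

abbreviation monom_var :: "nat \<Rightarrow> 'a::comm_ring_1 \<Rightarrow> nat multiset \<Rightarrow>\<^sub>0 'a" where
  "monom_var x c \<equiv> Poly_Mapping.single {#x#} c"

text \<open>The variable \<open>x\<close> itself has coefficient \<open>t + 1\<close>: a letter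
  equal to \<open>x\<close> may be barred or unbarred.\<close>

definition lin_form :: "nat set \<Rightarrow> 'a::comm_ring_1 \<Rightarrow> nat \<Rightarrow> nat multiset \<Rightarrow>\<^sub>0 'a" where
  "lin_form A t x = (\<Sum>y\<in>A. monom_var y ((if x \<le> y then t else 0) + (if y \<le> x then 1 else 0)))"

text \<open>The coefficient of MacMahon's master theorem: weighted words of content \<open>M\<close>
  without the restriction at block starts.\<close>

definition word_sum :: "'a::comm_ring_1 \<Rightarrow> nat multiset \<Rightarrow> 'a" where
  "word_sum t M = Poly_Mapping.lookup (\<Prod>x\<in>#M. lin_form (set_mset M) t x) M"

text \<open>A word with content \<open>M\<close> uses only letters of \<open>M\<close>, so enlarging
  the alphabet adds nothing.\<close>

lemma lookup_prod_lin_form: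
  assumes "finite A" "set_mset M \<subseteq> A"
  shows "Poly_Mapping.lookup (\<Prod>x\<in>#M. lin_form A t x) M = word_sum t M"
proof -
  obtain xs where xs: "M = mset xs" using ex_mset by metis
  define J where "J = {..<length xs}"
  have prod: "(\<Prod>x\<in>#M. lin_form B t x) = (\<Prod>j\<in>J. lin_form B t (xs ! j))" for B
    unfolding xs J_def by (simp add: prod.list_conv_set_nth atLeast0LessThan prod_mset_prod_list flip: mset_map)
  define w where "w j y = (if xs ! j \<le> y then t else 0) + (if y \<le> xs ! j then 1 else 0)" for j y
  have expand: "Poly_Mapping.lookup (\<Prod>x\<in>#M. lin_form B t x) M =
      (\<Sum>v | v \<in> J \<rightarrow>\<^sub>E B \<and> image_mset v (mset_set J) = M. \<Prod>j\<in>J. w j (v j))" if "finite B" for B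
    using lookup_prod_linear_forms[of J B "\<lambda>y. y" w M] that
    unfolding prod unfolding lin_form_def w_def by (simp add: J_def)
  have "{v. v \<in> J \<rightarrow>\<^sub>E A \<and> image_mset v (mset_set J) = M} =
      {v. v \<in> J \<rightarrow>\<^sub>E set_mset M \<and> image_mset v (mset_set J) = M}"
    using assms(2) by (auto simp: J_def PiE_def)
  then show ?thesis
    unfolding word_sum_def expand[OF assms(1)] expand[OF finite_set_mset] by simp
qed

text \<open>On generating functions this is multiplication by the product of all
  \<open>1 - w * x\<close>, \<open>x\<close> ranging over the letters.\<close>

definition alternating_sum :: "'a::comm_ring_1 \<Rightarrow> (nat multiset \<Rightarrow> 'a) \<Rightarrow> nat multiset \<Rightarrow> 'a" where
  "alternating_sum w f M = (\<Sum>S\<in>Pow (set_mset M). (- w) ^ card S * f (M - mset_set S))"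

lemma mset_set_subset_mset: "S \<subseteq> set_mset M \<Longrightarrow> mset_set S \<subseteq># M"
  by (rule mset_subset_eqI) (auto simp: count_mset_set' Suc_le_eq)

text \<open>Choosing \<open>- w * x\<close> for the letters \<open>x \<in> S\<close> leaves the
  product of linear forms over \<open>M - mset_set S\<close>, whose coefficient at
  \<open>M - mset_set S\<close> is a word sum.\<close>

lemma alternating_word_sum:
  "Poly_Mapping.lookup ((\<Prod>x\<in>set_mset M. lin_form (set_mset M) t x - monom_var x w) *
      (\<Prod>x\<in># M - mset_set (set_mset M). lin_form (set_mset M) t x)) M
    = alternating_sum w (word_sum t) M"
proof -
  define A where "A = set_mset M"
  define l where "l = lin_form A t"
  have fin: "finite A" by (simp add: A_def)
  have "(\<Prod>x\<in>A. l x - monom_var x w) = (\<Prod>x\<in>A. monom_var x (- w) + l x)"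
    by (intro prod.cong) (simp_all add: single_uminus)
  also have "\<dots> = (\<Sum>S\<in>Pow A. (\<Prod>x\<in>S. monom_var x (- w)) * prod l (A - S))"
    using fin by (rule prod_add)
  also have "\<dots> = (\<Sum>S\<in>Pow A. Poly_Mapping.single (mset_set S) ((- w) ^ card S) * prod l (A - S))"
    using fin by (intro sum.cong) (auto simp: prod_poly_mapping_single sum_single_mset finite_subset)
  finally have "(\<Prod>x\<in>A. l x - monom_var x w) * (\<Prod>x\<in># M - mset_set A. l x) =
      (\<Sum>S\<in>Pow A. Poly_Mapping.single (mset_set S) ((- w) ^ card S) * (prod l (A - S) * (\<Prod>x\<in># M - mset_set A. l x)))"
    by (simp add: sum_distrib_right mult.assoc)
  also have "\<dots> = (\<Sum>S\<in>Pow A. Poly_Mapping.single (mset_set S) ((- w) ^ card S) * (\<Prod>x\<in># M - mset_set S. l x))"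
  proof (intro sum.cong refl arg_cong2[where f = "(*)"])
    fix S assume "S \<in> Pow A"
    then have S: "S \<subseteq> A" "finite S" using fin finite_subset by auto
    have "mset_set A = mset_set (A - S) + mset_set S"
      using S fin by (metis mset_set_Union Diff_disjoint Un_Diff_cancel finite_Diff sup.absorb2 add.commute Int_commute)
    moreover have "M = mset_set A + (M - mset_set A)"
      by (simp add: A_def mset_set_set_mset_msubset)
    ultimately have "M = mset_set S + (mset_set (A - S) + (M - mset_set A))"
      by (simp add: ac_simps)
    then have "M - mset_set S = mset_set (A - S) + (M - mset_set A)"
      by (metis add_diff_cancel_left')
    then show "prod l (A - S) * (\<Prod>x\<in># M - mset_set A. l x) = (\<Prod>x\<in># M - mset_set S. l x)"
      by (simp add: prod_unfold_prod_mset)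
  qed
  finally have "Poly_Mapping.lookup ((\<Prod>x\<in>A. l x - monom_var x w) * (\<Prod>x\<in># M - mset_set A. l x)) M =
      (\<Sum>S\<in>Pow A. (- w) ^ card S * Poly_Mapping.lookup (\<Prod>x\<in># M - mset_set S. l x) (M - mset_set S))"
    by (auto simp: lookup_sum lookup_single_times mset_set_subset_mset A_def intro!: sum.cong)
  also have "\<dots> = alternating_sum w (word_sum t) M"
    unfolding alternating_sum_def A_def l_def
    by (intro sum.cong refl arg_cong2[where f = "(*)"] lookup_prod_lin_form)
      (auto dest: in_diffD)
  finally show ?thesis unfolding A_def l_def .
qed

text \<open>In \<open>lin_form A t x\<close>, subtracting \<open>x\<close> leaves \<open>t\<close>
  on the letters \<open>y \<ge> x\<close> and 1 below; subtracting \<open>t * x\<close> leaves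
  \<open>t\<close> on \<open>y > x\<close> and 1 elsewhere. These are the factors of the telescoping
  products with \<open>r = 0\<close>, which differ by the factor \<open>t\<close>.\<close>

lemma alternating_word_sum_eq:
  assumes "M \<noteq> {#}"
  shows "alternating_sum 1 (word_sum t) M = t * alternating_sum t (word_sum t) M"
proof -
  define A where "A = set_mset M"
  have A: "finite A" "A \<noteq> {}" using assms by (auto simp: A_def)
  define c where "c = (Poly_Mapping.single 0 t :: nat multiset \<Rightarrow>\<^sub>0 'a)"
  define f where "f y = (monom_var y 1 :: nat multiset \<Rightarrow>\<^sub>0 'a)" for y
  have cf: "monom_var y t = c * f y" for y by (simp add: c_def f_def mult_single)
  have l: "lin_form A t x = (\<Sum>y\<in>A. (if x \<le> y then c * f y else 0) + (if y \<le> x then f y else 0))" for x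
    unfolding lin_form_def by (intro sum.cong refl) (simp add: single_add cf f_def[symmetric])
  have 1: "lin_form A t x - monom_var x 1 = 0 + (\<Sum>y\<in>A. if x \<le> y then c * f y else f y)" if "x \<in> A" for x
  proof -
    have "f x = (\<Sum>y\<in>A. if y = x then f y else 0)" using that A by simp
    then show ?thesis
      unfolding l f_def[of x, symmetric] by (auto simp: sum_subtractf[symmetric] intro!: sum.cong)
  qed
  have 2: "lin_form A t x - monom_var x t = 0 + (\<Sum>y\<in>A. if x < y then c * f y else f y)" if "x \<in> A" for x
  proof -
    have "c * f x = (\<Sum>y\<in>A. if y = x then c * f y else 0)" using that A by simp
    then show ?thesis
      unfolding l cf by (auto simp: sum_subtractf[symmetric] intro!: sum.cong)
  qed
  obtain C where C: "(\<Prod>x\<in>A. 0 + (\<Sum>y\<in>A. if x \<le> y then c * f y else f y)) = (c * sum f A + 0) * C"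
    "(\<Prod>x\<in>A. 0 + (\<Sum>y\<in>A. if x < y then c * f y else f y)) = (sum f A + 0) * C"
    using telescoping_products[OF A] by blast
  have "(\<Prod>x\<in>A. lin_form A t x - monom_var x 1) = c * (\<Prod>x\<in>A. lin_form A t x - monom_var x t)"
    using C by (simp add: 1 2 cong: prod.cong)
  then have "Poly_Mapping.lookup ((\<Prod>x\<in>A. lin_form A t x - monom_var x 1) * (\<Prod>x\<in># M - mset_set A. lin_form A t x)) M
    = t * Poly_Mapping.lookup ((\<Prod>x\<in>A. lin_form A t x - monom_var x t) * (\<Prod>x\<in># M - mset_set A. lin_form A t x)) M"
    using lookup_single_times[of "{#}" M t] by (simp add: c_def mult.assoc)
  then show ?thesis unfolding A_def alternating_word_sum .
qed

lemma inj_on_block_starts: "inj_on s (block_starts n s)"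
proof (rule inj_onI)
  fix i j assume "i \<in> block_starts n s" "j \<in> block_starts n s" "s i = s j"
  then show "i = j" by (cases i j rule: linorder_cases) (auto simp: block_starts_def)
qed

text \<open>The least position of a value is a block start; with injectivity, each value of
  \<open>s\<close> has exactly one.\<close>

lemma image_block_starts: "s ` block_starts n s = s ` {1..n}"
proof (intro equalityI subsetI)
  fix x assume "x \<in> s ` {1..n}"
  then obtain i where i: "i \<in> {1..n}" "s i = x" by auto
  define j where "j = (LEAST j. j \<in> {1..n} \<and> s j = x)"
  have j: "j \<in> {1..n} \<and> s j = x" unfolding j_def by (rule LeastI[of _ i]) (use i in auto)
  have "s i' \<noteq> x" if "i' \<in> {1..<j}" for i'
    using not_less_Least[of i' "\<lambda>j. j \<in> {1..n} \<and> s j = x"] that j unfolding j_def[symmetric] by auto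
  with j have "j \<in> block_starts n s" by (auto simp: block_starts_def)
  with j show "x \<in> s ` block_starts n s" by auto
qed (auto simp: block_starts_def)

text \<open>Position \<open>j\<close> contributes the form of the letter \<open>s j\<close>, less
  \<open>t\<close> times that letter at a block start, where it must not be barred. With one block
  start per value, the product over all positions is the one in
  \<open>alternating_word_sum\<close>.\<close>

lemma sum_exc_words:
  "(\<Sum>v\<in>exc_words n s. t ^ card {j \<in> {1..n}. snd (v j)}) =
     alternating_sum t (word_sum t) (image_mset s (mset_set {1..n}))"
proof -
  define M where "M = image_mset s (mset_set {1..n})"
  define A where "A = s ` {1..n}"
  define B where "B = block_starts n s"
  define l where "l = lin_form A t"
  have A: "set_mset M = A" by (simp add: M_def A_def)
  have BS: "B \<subseteq> {1..n}" "finite B" by (auto simp: B_def block_starts_def)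
  \<comment> \<open>The weight of the letter \<open>z\<close> at position \<open>j\<close>, zero
    exactly for the choices that \<open>exc_words\<close> forbids, unless
    \<open>t = 0\<close>.\<close>
  define w where "w j z = (if snd z then (if s j \<le> fst z \<and> \<not> (j \<in> B \<and> fst z = s j) then t else 0)
      else (if fst z \<le> s j then 1 else 0))" for j and z :: "nat \<times> bool"
  define \<phi> where "\<phi> j = (\<Sum>z\<in>A\<times>UNIV. monom_var (fst z) (w j z))" for j
  have \<phi>: "\<phi> j = (if j \<in> B then l (s j) - monom_var (s j) t else l (s j))" if j: "j \<in> {1..n}" for j
  proof -
    have "\<phi> j = (\<Sum>y\<in>A. monom_var y (w j (y, True) + w j (y, False)))"
      unfolding \<phi>_def sum.cartesian_product' by (simp add: UNIV_bool single_add add.commute)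
    also have "\<dots> = (\<Sum>y\<in>A. monom_var y ((if s j \<le> y then t else 0) + (if y \<le> s j then 1 else 0))
          - (if y = s j then if j \<in> B then monom_var (s j) t else 0 else 0))"
      by (intro sum.cong) (auto simp: w_def single_add)
    also have "\<dots> = l (s j) - (if j \<in> B then monom_var (s j) t else 0)"
      using j unfolding sum_subtractf l_def lin_form_def by (simp add: A_def)
    finally show ?thesis by simp
  qed
  have "image_mset s (mset_set B) = mset_set A"
    using inj_on_block_starts[of s n] image_block_starts[of s n]
    by (simp add: image_mset_mset_set B_def A_def)
  moreover have "M = image_mset s (mset_set B) + image_mset s (mset_set ({1..n} - B))"
    unfolding M_def image_mset_union[symmetric] using BS
    by (subst mset_set_Union[symmetric]) (auto simp: Un_absorb1)
  ultimately have M: "image_mset s (mset_set ({1..n} - B)) = M - mset_set A" by simp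
  have "(\<Prod>j\<in>{1..n}. \<phi> j) = (\<Prod>j\<in>B. \<phi> j) * (\<Prod>j\<in>{1..n} - B. \<phi> j)"
    using BS prod.subset_diff[of B "{1..n}" \<phi>] by (simp add: mult.commute)
  also have "(\<Prod>j\<in>B. \<phi> j) = (\<Prod>j\<in>B. l (s j) - monom_var (s j) t)"
    using BS by (intro prod.cong) (auto simp: \<phi>)
  also have "\<dots> = (\<Prod>x\<in>A. l x - monom_var x t)"
    using prod.reindex[OF inj_on_block_starts, of "\<lambda>x. l x - monom_var x t" s n]
    by (simp add: image_block_starts A_def B_def)
  also have "(\<Prod>j\<in>{1..n} - B. \<phi> j) = (\<Prod>j\<in>{1..n} - B. l (s j))"
    by (intro prod.cong) (auto simp: \<phi>)
  also have "\<dots> = (\<Prod>x\<in># M - mset_set A. l x)"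
    unfolding M[symmetric] by (simp add: prod_unfold_prod_mset multiset.map_comp o_def)
  finally have prod: "Poly_Mapping.lookup (\<Prod>j\<in>{1..n}. \<phi> j) M = alternating_sum t (word_sum t) M"
    using alternating_word_sum[of M t t] unfolding A l_def by simp
  have "Poly_Mapping.lookup (\<Prod>j\<in>{1..n}. \<phi> j) M =
      (\<Sum>v | v \<in> {1..n} \<rightarrow>\<^sub>E A \<times> UNIV \<and> image_mset (\<lambda>j. fst (v j)) (mset_set {1..n}) = M.
        \<Prod>j\<in>{1..n}. w j (v j))"
    unfolding \<phi>_def by (rule lookup_prod_linear_forms) (auto simp: A_def)
  also have "\<dots> = (\<Sum>v\<in>exc_words n s. \<Prod>j\<in>{1..n}. w j (v j))"
  proof (rule sum.mono_neutral_right)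
    let ?V = "{v. v \<in> {1..n} \<rightarrow>\<^sub>E A \<times> (UNIV::bool set) \<and> image_mset (\<lambda>j. fst (v j)) (mset_set {1..n}) = M}"
    have "finite ({1..n} \<rightarrow>\<^sub>E A \<times> (UNIV::bool set))" by (intro finite_PiE) (auto simp: A_def)
    then show "finite ?V" by (rule finite_subset[rotated]) blast
    show "exc_words n s \<subseteq> ?V" unfolding exc_words_def A_def M_def by blast
    show "\<forall>v\<in>?V - exc_words n s. (\<Prod>j\<in>{1..n}. w j (v j)) = 0"
    proof
      fix v assume v: "v \<in> ?V - exc_words n s"
      then consider j where "j \<in> {1..n}" "\<not> (if snd (v j) then s j \<le> fst (v j) else fst (v j) \<le> s j)"
        | j where "j \<in> B" "v j = (s j, True)"
        unfolding exc_words_def A_def M_def B_def by blast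
      then have "\<exists>j\<in>{1..n}. w j (v j) = 0"
      proof cases
        case (1 j)
        then show ?thesis by (intro bexI[of _ j]) (auto simp: w_def split: if_splits)
      next
        case (2 j)
        then show ?thesis using BS(1) by (intro bexI[of _ j]) (auto simp: w_def)
      qed
      then show "(\<Prod>j\<in>{1..n}. w j (v j)) = 0" by (intro prod_zero) auto
    qed
  qed
  also have "\<dots> = (\<Sum>v\<in>exc_words n s. t ^ card {j \<in> {1..n}. snd (v j)})"
  proof (rule sum.cong[OF refl])
    fix v assume v: "v \<in> exc_words n s"
    have "w j (v j) = (if snd (v j) then t else 1)" if "j \<in> {1..n}" for j
    proof -
      have "if snd (v j) then s j \<le> fst (v j) else fst (v j) \<le> s j"
        using v that unfolding exc_words_def by blast
      moreover have "j \<in> B \<Longrightarrow> v j \<noteq> (s j, True)"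
        using v unfolding exc_words_def B_def by blast
      ultimately show ?thesis by (cases "v j") (auto simp: w_def split: if_splits)
    qed
    then have "(\<Prod>j\<in>{1..n}. w j (v j)) = (\<Prod>j\<in>{1..n}. if snd (v j) then t else 1)"
      by (rule prod.cong[OF refl])
    then show "(\<Prod>j\<in>{1..n}. w j (v j)) = t ^ card {j \<in> {1..n}. snd (v j)}"
      by (simp add: prod.If_cases Int_def)
  qed
  finally show ?thesis using prod unfolding M_def by simp
qed

section \<open>Generating functions over multisets\<close>

definition msets :: "nat \<Rightarrow> nat \<Rightarrow> nat multiset set" where
  "msets m n = {M. size M = n \<and> set_mset M \<subseteq> {..<m}}"

lemma finite_msets [simp]: "finite (msets m n)"
proof (rule finite_subset)
  show "msets m n \<subseteq> mset ` {xs. set xs \<subseteq> {..<m} \<and> length xs = n}"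
  proof
    fix M assume "M \<in> msets m n"
    moreover obtain xs where "M = mset xs" using ex_mset by metis
    ultimately show "M \<in> mset ` {xs. set xs \<subseteq> {..<m} \<and> length xs = n}" by (auto simp: msets_def)
  qed
qed (auto intro: finite_lists_length_eq)

text \<open>The series with coefficient \<open>f M\<close> at the monomial \<open>M\<close>,
  specialised by replacing each letter \<open>x < m\<close> by \<open>z * q ^ x\<close>.\<close>

definition mset_gf :: "'a::comm_ring_1 \<Rightarrow> nat \<Rightarrow> (nat multiset \<Rightarrow> 'a) \<Rightarrow> 'a fps" where
  "mset_gf q m f = Abs_fps (\<lambda>n. \<Sum>M\<in>msets m n. q ^ sum_mset M * f M)"

text \<open>The finite q-Pochhammer symbol (wz; q)_m.\<close>

definition euler_prod :: "'a::comm_ring_1 \<Rightarrow> nat \<Rightarrow> 'a \<Rightarrow> 'a fps" where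
  "euler_prod q m w = (\<Prod>x<m. 1 - fps_const (w * q ^ x) * fps_X)"

lemma euler_prod_expand:
  "euler_prod q m w =
    (\<Sum>S\<in>Pow {..<m}. fps_const ((- w) ^ card S * q ^ \<Sum>S) * fps_X ^ card S)"
proof -
  have "euler_prod q m w = (\<Prod>x<m. - fps_const (w * q ^ x) * fps_X + 1)"
    unfolding euler_prod_def by (intro prod.cong refl) (simp flip: fps_const_neg)
  also have "\<dots> = (\<Sum>S\<in>Pow {..<m}. (\<Prod>x\<in>S. - fps_const (w * q ^ x) * fps_X) * (\<Prod>x\<in>{..<m} - S. 1))"
    by (rule prod_add) simp
  also have "\<dots> = (\<Sum>S\<in>Pow {..<m}. fps_const ((- w) ^ card S * q ^ \<Sum>S) * fps_X ^ card S)"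
  proof (rule sum.cong[OF refl])
    fix S assume "S \<in> Pow {..<m}"
    then have "finite S" using finite_subset by auto
    then have "(\<Prod>x\<in>S. - fps_const (w * q ^ x) * fps_X) = fps_const ((- w) ^ card S * q ^ \<Sum>S) * fps_X ^ card S"
      by (induction S rule: finite_induct) (auto simp: power_add algebra_simps simp flip: fps_const_mult fps_const_neg)
    then show "(\<Prod>x\<in>S. - fps_const (w * q ^ x) * fps_X) * (\<Prod>x\<in>{..<m} - S. 1) =
      fps_const ((- w) ^ card S * q ^ \<Sum>S) * fps_X ^ card S" by simp
  qed
  finally show ?thesis .
qed

lemma sum_mset_mset_set: "sum_mset (mset_set S) = \<Sum>S"
  by (simp add: sum_unfold_sum_mset)

text \<open>A multiset \<open>N\<close> and a set \<open>S\<close> of letters taken from the Euler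
  factors correspond to \<open>M = N + mset_set S\<close> with a marked subset \<open>S\<close> of
  its support.\<close>

lemma mset_gf_times_euler_prod:
  "mset_gf q m f * euler_prod q m w = mset_gf q m (alternating_sum w f)"
proof (rule fps_ext)
  fix n
  \<comment> \<open>The case split is needed because \<open>n - card S\<close> truncates to
    0.\<close>
  let ?N = "\<lambda>S. if card S \<le> n then msets m (n - card S) else {}"
  have "(mset_gf q m f * euler_prod q m w) $ n =
      (\<Sum>S\<in>Pow {..<m}. (- w) ^ card S * q ^ \<Sum>S * (if n < card S then 0 else mset_gf q m f $ (n - card S)))"
    unfolding euler_prod_expand sum_distrib_left fps_sum_nth
  proof (rule sum.cong[OF refl])
    fix S
    have "mset_gf q m f * (fps_const ((- w) ^ card S * q ^ \<Sum>S) * fps_X ^ card S) =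
      fps_const ((- w) ^ card S * q ^ \<Sum>S) * (mset_gf q m f * fps_X ^ card S)" by (simp add: mult_ac)
    then show "(mset_gf q m f * (fps_const ((- w) ^ card S * q ^ \<Sum>S) * fps_X ^ card S)) $ n =
      (- w) ^ card S * q ^ \<Sum>S * (if n < card S then 0 else mset_gf q m f $ (n - card S))"
      by (simp only: fps_mult_left_const_nth fps_X_power_mult_right_nth)
  qed
  also have "\<dots> = (\<Sum>S\<in>Pow {..<m}. \<Sum>N\<in>?N S. (- w) ^ card S * q ^ \<Sum>S * (q ^ sum_mset N * f N))"
    by (intro sum.cong refl) (auto simp: mset_gf_def sum_distrib_left)
  also have "\<dots> = (\<Sum>(S, N)\<in>Sigma (Pow {..<m}) ?N. (- w) ^ card S * q ^ \<Sum>S * (q ^ sum_mset N * f N))"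
    by (rule sum.Sigma) auto
  also have "\<dots> = (\<Sum>(M, S)\<in>Sigma (msets m n) (\<lambda>M. Pow (set_mset M)). q ^ sum_mset M * ((- w) ^ card S * f (M - mset_set S)))"
  proof (rule sum.reindex_bij_witness[of _ "\<lambda>(M, S). (S, M - mset_set S)" "\<lambda>(S, N). (N + mset_set S, S)"], goal_cases)
    case (2 a)
    then obtain S N where a: "a = (S, N)" "S \<subseteq> {..<m}" "N \<in> ?N S" by auto
    then have "finite S" using finite_subset by auto
    then show ?case using a by (auto simp: msets_def split: if_splits)
  next
    case (4 b)
    then obtain M S where b: "b = (M, S)" "M \<in> msets m n" "S \<subseteq> set_mset M" by auto
    then have "finite S" using finite_subset by auto
    moreover have "mset_set S \<subseteq># M" using b(3) by (rule mset_set_subset_mset)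
    moreover from this have "card S \<le> n" using size_mset_mono b \<open>finite S\<close> by (fastforce simp: msets_def)
    ultimately show ?case using b by (auto simp: msets_def size_Diff_submset dest: in_diffD)
  next
    case (5 a)
    then show ?case by (auto simp: sum_mset_mset_set power_add mult_ac)
  qed (auto simp: mset_set_subset_mset)
  also have "\<dots> = (\<Sum>M\<in>msets m n. \<Sum>S\<in>Pow (set_mset M). q ^ sum_mset M * ((- w) ^ card S * f (M - mset_set S)))"
    by (rule sum.Sigma[symmetric]) auto
  also have "\<dots> = mset_gf q m (alternating_sum w f) $ n"
    by (simp add: mset_gf_def alternating_sum_def sum_distrib_left)
  finally show "(mset_gf q m f * euler_prod q m w) $ n = mset_gf q m (alternating_sum w f) $ n" .
qed

lemma mset_gf_cong:
  "(\<And>M. set_mset M \<subseteq> {..<m} \<Longrightarrow> f M = g M) \<Longrightarrow> mset_gf q m f = mset_gf q m g"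
  by (auto simp: mset_gf_def msets_def fps_eq_iff intro!: sum.cong)

lemma mset_gf_indicator: "mset_gf q m (\<lambda>M. if M = {#} then c else 0) = fps_const c"
proof (rule fps_ext)
  fix n
  have "(\<Sum>M\<in>msets m n. q ^ sum_mset M * (if M = {#} then c else 0)) = (\<Sum>M\<in>msets m n. if M = {#} then c else 0)"
    by (intro sum.cong) auto
  also have "\<dots> = (if n = 0 then c else 0)" by (simp, auto simp: msets_def)
  finally show "mset_gf q m (\<lambda>M. if M = {#} then c else 0) $ n = fps_const c $ n"
    by (simp add: mset_gf_def)
qed

section \<open>Complete homogeneous sums\<close>

lemma sum_Pow_neg_one:
  assumes "finite A"
  shows "(\<Sum>S\<in>Pow A. (- 1) ^ card S) = (if A = {} then 1 else (0::'a::comm_ring_1))"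
proof -
  have "(\<Prod>x\<in>A. - 1 + (1::'a)) = (\<Sum>S\<in>Pow A. (\<Prod>x\<in>S. - 1) * (\<Prod>x\<in>A - S. 1))"
    using assms by (rule prod_add)
  then show ?thesis using assms by (auto simp: power_0_left)
qed

lemma alternating_sum_power_size:
  "alternating_sum w (\<lambda>M. w ^ size M) M = (if M = {#} then 1 else 0)"
proof -
  have "alternating_sum w (\<lambda>M. w ^ size M) M = (\<Sum>S\<in>Pow (set_mset M). w ^ size M * (- 1) ^ card S)"
    unfolding alternating_sum_def
  proof (rule sum.cong[OF refl])
    fix S assume S: "S \<in> Pow (set_mset M)"
    then have "mset_set S \<subseteq># M" by (auto intro: mset_set_subset_mset)
    moreover have "finite S" using S finite_subset by auto
    ultimately have "size M = card S + size (M - mset_set S)"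
      by (metis size_mset_set size_union subset_mset.add_diff_inverse)
    then show "(- w) ^ card S * w ^ size (M - mset_set S) = w ^ size M * (- 1) ^ card S"
      by (simp add: power_add power_minus[of w] mult_ac)
  qed
  also have "\<dots> = (if M = {#} then 1 else 0)"
    by (simp add: sum_Pow_neg_one flip: sum_distrib_left)
  finally show ?thesis .
qed

text \<open>The complete homogeneous symmetric polynomial of degree \<open>k\<close> at 1, q, ...,
  q^(m-1).\<close>

definition complete_sum :: "'a::comm_ring_1 \<Rightarrow> nat \<Rightarrow> nat \<Rightarrow> 'a" where
  "complete_sum q m k = (\<Sum>M\<in>msets m k. q ^ sum_mset M)"

definition complete_fps :: "'a::comm_ring_1 \<Rightarrow> nat \<Rightarrow> 'a \<Rightarrow> 'a fps" where
  "complete_fps q m w = Abs_fps (\<lambda>k. w ^ k * complete_sum q m k)"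

lemma complete_fps_times_euler_prod: "complete_fps q m w * euler_prod q m w = 1"
proof -
  have "complete_fps q m w = mset_gf q m (\<lambda>M. w ^ size M)"
    by (auto simp: complete_fps_def complete_sum_def mset_gf_def sum_distrib_left msets_def fps_eq_iff intro!: sum.cong)
  then show ?thesis
    using mset_gf_indicator[of q m 1]
    by (simp add: mset_gf_times_euler_prod alternating_sum_power_size[abs_def])
qed

text \<open>If \<open>F\<close> is the generating function of the word sums, then
  \<open>P = F * E(t)\<close> and \<open>F * E(1) - t * P = 1 - t\<close>. Multiplying by the
  inverses of the Euler products eliminates \<open>F\<close>.\<close>

lemma alternating_word_sum_gf:
  "mset_gf q m (alternating_sum t (word_sum t)) * (complete_fps q m t - fps_const t * complete_fps q m 1)
     = fps_const (1 - t) * complete_fps q m 1"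
proof -
  define F where "F = mset_gf q m (word_sum t)"
  define P where "P = mset_gf q m (alternating_sum t (word_sum t))"
  let ?E = "euler_prod q m" and ?H = "complete_fps q m"
  have P: "P = F * ?E t" by (simp add: P_def F_def mset_gf_times_euler_prod)
  have "F * ?E 1 - fps_const t * P =
      mset_gf q m (\<lambda>M. alternating_sum 1 (word_sum t) M - t * alternating_sum t (word_sum t) M)"
    unfolding F_def P_def mset_gf_times_euler_prod
    by (simp add: fps_eq_iff mset_gf_def sum_distrib_left sum_subtractf algebra_simps)
  also have "\<dots> = mset_gf q m (\<lambda>M. if M = {#} then 1 - t else 0)"
  proof (rule mset_gf_cong)
    fix M :: "nat multiset"
    show "alternating_sum 1 (word_sum t) M - t * alternating_sum t (word_sum t) M = (if M = {#} then 1 - t else 0)"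
    proof (cases "M = {#}")
      \<comment> \<open>Both alternating sums are 1 at the empty multiset; this is the source of the
        constant \<open>1 - t\<close>.\<close>
      case True
      then show ?thesis by (simp add: alternating_sum_def word_sum_def)
    qed (simp add: alternating_word_sum_eq)
  qed
  also have "\<dots> = fps_const (1 - t)" by (rule mset_gf_indicator)
  finally have F: "F * ?E 1 - fps_const t * P = fps_const (1 - t)" .
  have "P * (?H t - fps_const t * ?H 1) = F * (?H t * ?E t) - fps_const t * P * ?H 1"
    by (simp add: P algebra_simps)
  also have "\<dots> = F * (?H 1 * ?E 1) - fps_const t * P * ?H 1"
    by (simp add: complete_fps_times_euler_prod)
  also have "\<dots> = (F * ?E 1 - fps_const t * P) * ?H 1"
    by (simp add: algebra_simps)
  finally show ?thesis unfolding F unfolding P_def .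
qed

lemma complete_sum_0: "complete_sum q m 0 = 1"
proof -
  have "msets m 0 = {{#}}" by (auto simp: msets_def)
  then show ?thesis by (simp add: complete_sum_def)
qed

text \<open>A q-Pascal recurrence, read off from the last Euler factor, that of the letter
  \<open>m\<close>.\<close>

lemma complete_sum_Suc_Suc:
  "complete_sum q (Suc m) (Suc k) = complete_sum q m (Suc k) + q ^ m * complete_sum q (Suc m) k"
proof -
  let ?H = "\<lambda>m. complete_fps q m 1" and ?E = "\<lambda>m. euler_prod q m 1"
  have E: "?E (Suc m) = ?E m * (1 - fps_const (q ^ m) * fps_X)"
    by (simp add: euler_prod_def)
  have "?H m = ?H m * (?H (Suc m) * ?E (Suc m))"
    by (simp add: complete_fps_times_euler_prod)
  also have "\<dots> = (?H m * ?E m) * (?H (Suc m) * (1 - fps_const (q ^ m) * fps_X))"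
    unfolding E by (simp only: mult_ac)
  also have "\<dots> = ?H (Suc m) - fps_const (q ^ m) * (?H (Suc m) * fps_X)"
    by (simp add: complete_fps_times_euler_prod algebra_simps)
  finally have "?H m $ Suc k = (?H (Suc m) - fps_const (q ^ m) * (?H (Suc m) * fps_X)) $ Suc k"
    by simp
  then show ?thesis by (simp add: complete_fps_def)
qed

lemma complete_sum_closed_form:
  "complete_sum q m k * (\<Prod>i=1..k. 1 - q ^ i) = (\<Prod>i<k. 1 - q ^ (m + i))"
proof (induction k arbitrary: m)
  case 0
  then show ?case by (simp add: complete_sum_0)
next
  case (Suc k)
  show ?case
  proof (induction m)
    case 0
    have "msets 0 (Suc k) = {}" by (auto simp: msets_def)
    \<comment> \<open>With no letters the right side vanishes through its first factor
      \<open>1 - q ^ 0\<close>.\<close>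
    then show ?case by (simp add: complete_sum_def prod.lessThan_Suc_shift del: prod.lessThan_Suc)
  next
    case (Suc m)
    let ?D = "\<Prod>i=1..k. 1 - q ^ i" and ?N = "\<Prod>i<k. 1 - q ^ (Suc m + i)"
    have "complete_sum q (Suc m) (Suc k) * (\<Prod>i=1..Suc k. 1 - q ^ i) =
        complete_sum q m (Suc k) * (\<Prod>i=1..Suc k. 1 - q ^ i)
          + q ^ m * (complete_sum q (Suc m) k * ?D) * (1 - q ^ Suc k)"
      by (simp add: complete_sum_Suc_Suc algebra_simps)
    also have "\<dots> = (\<Prod>i<Suc k. 1 - q ^ (m + i)) + q ^ m * ?N * (1 - q ^ Suc k)"
      by (simp only: Suc.IH \<open>\<And>m. complete_sum q m k * ?D = _\<close>)
    also have "(\<Prod>i<Suc k. 1 - q ^ (m + i)) = (1 - q ^ m) * ?N"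
      by (simp add: prod.lessThan_Suc_shift del: prod.lessThan_Suc)
    also have "(1 - q ^ m) * ?N + q ^ m * ?N * (1 - q ^ Suc k) = ?N * (1 - q ^ (Suc m + k))"
      by (simp add: algebra_simps power_add)
    finally show ?case by simp
  qed
qed

lemma complete_sum_tendsto:
  fixes q :: real
  assumes "0 < q" "q < 1"
  shows "(\<lambda>m. complete_sum q m k) \<longlonglongrightarrow> 1 / (\<Prod>i=1..k. 1 - q ^ i)"
proof -
  have nz: "(\<Prod>i=1..k. 1 - q ^ i) \<noteq> 0"
  proof (rule notI)
    assume "(\<Prod>i=1..k. 1 - q ^ i) = 0"
    then obtain i where "1 \<le> i" "q ^ i = 1" by (auto simp: prod_zero_iff)
    moreover have "q ^ i < 1" using assms \<open>1 \<le> i\<close> by (intro power_less_one_iff[THEN iffD2]) auto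
    ultimately show False by simp
  qed
  have "(\<lambda>m. q ^ (m + i)) \<longlonglongrightarrow> 0" for i
    using assms LIMSEQ_ignore_initial_segment[OF LIMSEQ_power_zero[of q], of i] by simp
  then have "(\<lambda>m. (\<Prod>i<k. 1 - q ^ (m + i)) / (\<Prod>i=1..k. 1 - q ^ i)) \<longlonglongrightarrow>
      (\<Prod>i<k. 1 - 0) / (\<Prod>i=1..k. 1 - q ^ i)"
    by (intro tendsto_divide tendsto_prod tendsto_diff tendsto_const nz)
  moreover have "complete_sum q m k = (\<Prod>i<k. 1 - q ^ (m + i)) / (\<Prod>i=1..k. 1 - q ^ i)" for m
    using complete_sum_closed_form[of q m k] nz by (simp add: nonzero_eq_divide_eq)
  ultimately show ?thesis by simp
qed

section \<open>The limit of infinitely many letters\<close>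

definition decr_funs :: "nat \<Rightarrow> nat \<Rightarrow> (nat \<Rightarrow> nat) set" where
  "decr_funs m n = {s \<in> {1..n} \<rightarrow>\<^sub>E {..<m}. antimono_on {1..n} s}"

lemma finite_decr_funs [simp]: "finite (decr_funs m n)"
  unfolding decr_funs_def by (rule finite_subset[OF _ finite_PiE[of "{1..n}" "\<lambda>_. {..<m}"]]) auto

text \<open>Each multiset has exactly one weakly decreasing arrangement.\<close>

lemma bij_betw_decr_funs_msets:
  "bij_betw (\<lambda>s. image_mset s (mset_set {1..n})) (decr_funs m n) (msets m n)"
proof (rule bij_betw_imageI)
  show "inj_on (\<lambda>s. image_mset s (mset_set {1..n})) (decr_funs m n)"
  proof (rule inj_onI)
    fix s s' assume s: "s \<in> decr_funs m n" and s': "s' \<in> decr_funs m n"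
      and eq: "image_mset s (mset_set {1..n}) = image_mset s' (mset_set {1..n})"
    have "s i = s' i" if i: "i \<in> {1..n}" for i
    proof -
      have "- int (s i) = - int (s' i)"
      proof (rule mono_on_eq_if_image_mset_eq[OF _ _ _ i])
        show "mono_on {1..n} (\<lambda>i. - int (s i))" "mono_on {1..n} (\<lambda>i. - int (s' i))"
          using s s' by (auto simp: decr_funs_def monotone_on_def)
        show "image_mset (\<lambda>i. - int (s i)) (mset_set {1..n}) = image_mset (\<lambda>i. - int (s' i)) (mset_set {1..n})"
          using arg_cong[OF eq, of "image_mset (\<lambda>x. - int x)"] by (simp add: multiset.map_comp o_def)
      qed
      then show ?thesis by simp
    qed
    then show "s = s'"
      using s s' by (intro PiE_ext[of s "{1..n}" "\<lambda>_. {..<m}" s']) (auto simp: decr_funs_def)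
  qed
  show "(\<lambda>s. image_mset s (mset_set {1..n})) ` decr_funs m n = msets m n"
  proof (intro equalityI subsetI)
    fix M assume "M \<in> (\<lambda>s. image_mset s (mset_set {1..n})) ` decr_funs m n"
    then show "M \<in> msets m n" by (auto simp: decr_funs_def msets_def PiE_iff)
  next
    fix M assume M: "M \<in> msets m n"
    define xs where "xs = rev (sorted_list_of_multiset M)"
    have xs: "mset xs = M" "length xs = n" "sorted (rev xs)" "set xs \<subseteq> {..<m}"
      using M by (auto simp: xs_def msets_def simp flip: size_mset)
    define s where "s = (\<lambda>i\<in>{1..n}. xs ! (i - 1))"
    have "s i \<ge> s j" if "i \<in> {1..n}" "j \<in> {1..n}" "i \<le> j" for i j
      using that xs(2) sorted_rev_nth_mono[OF xs(3), of "i - 1" "j - 1"] by (auto simp: s_def)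
    moreover have "s i < m" if "i \<in> {1..n}" for i
          proof -
      have "xs ! (i - 1) \<in> set xs" using that xs(2) by (intro nth_mem) auto
      then show ?thesis using that xs(4) by (auto simp: s_def)
    qed
    ultimately have "s \<in> decr_funs m n" by (auto simp: decr_funs_def monotone_on_def s_def)
    moreover have "M = image_mset s (mset_set {1..n})"
    proof -
      have "map s [1..<Suc n] = xs"
        by (rule nth_equalityI) (auto simp: xs(2) s_def simp del: upt_Suc)
      moreover have "mset_set {1..n} = mset [1..<Suc n]"
        by (metis atLeastLessThanSuc_atLeastAtMost mset_upt)
      ultimately show ?thesis using xs(1) by (metis mset_map)
    qed
    ultimately show "M \<in> (\<lambda>s. image_mset s (mset_set {1..n})) ` decr_funs m n" by blast
  qed
qed

lemma sum_msets_conv_decr_funs: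
  "(\<Sum>M\<in>msets m n. q ^ sum_mset M * f M) =
     (\<Sum>s\<in>decr_funs m n. q ^ (\<Sum>i=1..n. s i) * f (image_mset s (mset_set {1..n})) :: 'a::comm_ring_1)"
  by (subst sum.reindex_bij_betw[OF bij_betw_decr_funs_msets, symmetric]) (simp add: sum_unfold_sum_mset)

lemma antimono_on_interval_stepI:
  fixes f :: "nat \<Rightarrow> 'a::linorder"
  assumes "\<And>i. 1 \<le> i \<Longrightarrow> i < n \<Longrightarrow> f (Suc i) \<le> f i"
  shows "antimono_on {1..n} f"
proof (rule monotone_onI)
  fix i j assume ij: "i \<in> {1..n}" "j \<in> {1..n}" "i \<le> j"
  have "k \<le> n \<longrightarrow> f k \<le> f i" if "i \<le> k" for k
    using that
  proof (induction k rule: dec_induct)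
    case (step k)
    then show ?case using assms[of k] ij by (auto intro: order_trans)
  qed simp
  then show "f j \<le> f i" using ij by auto
qed

text \<open>Subtract from \<open>s i\<close> the number \<open>c i\<close> of elements of
  \<open>D\<close> that are at least \<open>i\<close>. Strict descents at \<open>D\<close> become
  weak, the exponent drops by \<open>\<Sum>D\<close> because \<open>j \<in> D\<close> is counted for
  \<open>i = 1, ..., j\<close>, and \<open>s 1\<close> drops by \<open>card D\<close>, which
  explains the alphabet size.\<close>

lemma sum_strictly_decr_funs:
  assumes D: "D \<subseteq> {1..n-1}"
  shows "(\<Sum>s | s \<in> decr_funs (m + card D) n \<and> (\<forall>i\<in>D. s i \<noteq> s (i + 1)). q ^ (\<Sum>i=1..n. s i)) =
    q ^ \<Sum>D * (complete_sum q m n :: 'a::comm_ring_1)"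
proof -
  define c where "c i = card (D \<inter> {i..})" for i
  have finD: "finite D" using D finite_subset by blast
  have c_Suc: "c i = c (Suc i) + (if i \<in> D then 1 else 0)" for i
  proof -
    have "D \<inter> {i..} = (if i \<in> D then insert i (D \<inter> {Suc i..}) else D \<inter> {Suc i..})"
      by (auto simp: Suc_le_eq le_less)
    then show ?thesis using finD by (simp add: c_def)
  qed
  have c_mono: "c j \<le> c i" if "i \<le> j" for i j
    unfolding c_def using that finD by (intro card_mono) auto
  have c_le: "c i \<le> card D" for i
    unfolding c_def using finD by (intro card_mono) auto
  have c_n: "c n = 0"
  proof -
    have "D \<inter> {n..} = {}" using D by fastforce
    then show ?thesis by (simp add: c_def)
  qed
  have c_1: "c 1 = card D"
  proof -
    have "D \<inter> {1..} = D" using D by auto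
    then show ?thesis by (simp add: c_def)
  qed
  have sum_c: "(\<Sum>i=1..n. c i) = \<Sum>D"
  proof -
    have "(\<Sum>i=1..n. c i) = (\<Sum>i=1..n. \<Sum>j\<in>D. if i \<le> j then 1 else 0)"
      using finD by (intro sum.cong refl) (simp add: c_def sum.If_cases Int_def)
    also have "\<dots> = (\<Sum>j\<in>D. \<Sum>i=1..n. if i \<le> j then 1 else 0)"
      by (rule sum.swap)
    also have "\<dots> = (\<Sum>j\<in>D. j)"
    proof (rule sum.cong[OF refl])
      fix j assume "j \<in> D"
      then have "j \<le> n" using D by fastforce
      then have "{1..n} \<inter> {i. i \<le> j} = {1..j}" by auto
      then show "(\<Sum>i=1..n. if i \<le> j then 1 else 0) = j" by (simp add: sum.If_cases)
    qed
    finally show ?thesis .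
  qed
  \<comment> \<open>Differences are taken in the integers first; as they decrease weakly and
    \<open>c n = 0\<close>, they are nonnegative, so natural subtraction does not truncate.\<close>
  have shifted: "c i \<le> s i" "antimono_on {1..n} (\<lambda>i. int (s i) - int (c i))"
    if s: "s \<in> decr_funs (m + card D) n" "\<forall>i\<in>D. s i \<noteq> s (i + 1)" and "i \<in> {1..n}" for s i
  proof -
    show *: "antimono_on {1..n} (\<lambda>i. int (s i) - int (c i))"
    proof (rule antimono_on_interval_stepI)
      fix i assume i: "1 \<le> i" "i < n"
      then have "i \<in> {1..n}" "Suc i \<in> {1..n}" "i \<le> Suc i" by auto
      then have "s (Suc i) \<le> s i" using s(1) unfolding decr_funs_def monotone_on_def by blast
      moreover have "i \<in> D \<Longrightarrow> s i \<noteq> s (Suc i)" using s(2) by simp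
      ultimately show "int (s (Suc i)) - int (c (Suc i)) \<le> int (s i) - int (c i)"
        using c_Suc[of i] by (cases "i \<in> D") auto
    qed
    have "n \<in> {1..n}" "i \<le> n" using that(3) by auto
    with * that(3) have "int (s n) - int (c n) \<le> int (s i) - int (c i)"
      unfolding monotone_on_def by blast
    then show "c i \<le> s i" using c_n by simp
  qed
  have "q ^ \<Sum>D * complete_sum q m n = (\<Sum>s\<in>decr_funs m n. q ^ \<Sum>D * q ^ (\<Sum>i=1..n. s i))"
    using sum_msets_conv_decr_funs[of q "\<lambda>_. 1" m n] by (simp add: complete_sum_def sum_distrib_left)
  also have "\<dots> = (\<Sum>s | s \<in> decr_funs (m + card D) n \<and> (\<forall>i\<in>D. s i \<noteq> s (i + 1)). q ^ (\<Sum>i=1..n. s i))"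
  proof (rule sum.reindex_bij_witness[of _ "\<lambda>s. \<lambda>i\<in>{1..n}. s i - c i" "\<lambda>s. \<lambda>i\<in>{1..n}. s i + c i"], goal_cases)
    case (1 s)
    then show ?case
      by (intro extensionalityI[of _ "{1..n}"]) (auto simp: decr_funs_def PiE_def)
  next
    case (2 s)
    let ?s = "\<lambda>i\<in>{1..n}. s i + c i"
    have "?s \<in> decr_funs (m + card D) n"
      unfolding decr_funs_def
    proof (intro CollectI conjI monotone_onI)
      show "?s \<in> {1..n} \<rightarrow>\<^sub>E {..<m + card D}"
        using 2 c_le by (auto simp: decr_funs_def PiE_iff intro!: add_less_le_mono)
      fix i j assume "i \<in> {1..n}" "j \<in> {1..n}" "i \<le> j"
      then show "?s j \<le> ?s i" using 2 c_mono[of i j] by (auto simp: decr_funs_def monotone_on_def intro!: add_mono)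
    qed
    moreover have "?s i \<noteq> ?s (i + 1)" if "i \<in> D" for i
    proof -
      have "i \<in> {1..n-1}" using that D by blast
      then have "i \<in> {1..n}" "Suc i \<in> {1..n}" "i \<le> Suc i" by auto
      moreover from this have "s (Suc i) \<le> s i" using 2 unfolding decr_funs_def monotone_on_def by blast
      ultimately show ?thesis using c_Suc[of i] that by simp
    qed
    ultimately show ?case by blast
  next
    case (3 s)
    then show ?case using shifted(1)[of s]
      by (intro extensionalityI[of _ "{1..n}"]) (auto simp: decr_funs_def PiE_def)
  next
    case (4 s)
    then have s: "s \<in> decr_funs (m + card D) n" "\<forall>i\<in>D. s i \<noteq> s (i + 1)" by auto
    note sh = shifted[OF s]
    show ?case
      unfolding decr_funs_def
    proof (intro CollectI conjI monotone_onI)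
      show "(\<lambda>i\<in>{1..n}. s i - c i) \<in> {1..n} \<rightarrow>\<^sub>E {..<m}"
      proof (rule restrict_PiE_iff[THEN iffD2], rule ballI)
        fix i assume i: "i \<in> {1..n}"
        then have "1 \<in> {1..n}" "1 \<le> i" by auto
        with i have "int (s i) - int (c i) \<le> int (s 1) - int (c 1)"
          using sh(2)[OF i] unfolding monotone_on_def by blast
        moreover have "s 1 < m + card D" using s(1) \<open>1 \<in> {1..n}\<close> by (auto simp: decr_funs_def PiE_iff)
        ultimately show "s i - c i \<in> {..<m}" using sh(1)[OF i] c_1 by auto
      qed
      fix i j assume ij: "i \<in> {1..n}" "j \<in> {1..n}" "i \<le> j"
      then have "int (s j) - int (c j) \<le> int (s i) - int (c i)"
        using sh(2)[OF ij(1)] unfolding monotone_on_def by blast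
      then show "(\<lambda>i\<in>{1..n}. s i - c i) j \<le> (\<lambda>i\<in>{1..n}. s i - c i) i"
        using sh(1)[OF ij(1)] sh(1)[OF ij(2)] ij by simp
    qed
  next
    case (5 s)
    have "(\<Sum>i=1..n. (\<lambda>i\<in>{1..n}. s i + c i) i) = (\<Sum>i=1..n. s i) + \<Sum>D"
      by (simp add: sum.distrib flip: sum_c)
    then show ?case by (simp add: power_add mult.commute)
  qed
  finally show ?thesis ..
qed

text \<open>Double counting of compatible pairs: the left side groups them by \<open>s\<close>, the
  right side by \<open>\<sigma>\<close>.\<close>

lemma mset_gf_alternating_word_sum_nth:
  "mset_gf q m (alternating_sum t (word_sum t)) $ n =
    (\<Sum>\<sigma> | \<sigma> permutes {1..n}. t ^ exc n \<sigma> *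
       (\<Sum>s | s \<in> decr_funs m n \<and> (\<forall>i\<in>DEX n \<sigma>. s i \<noteq> s (i + 1)). q ^ (\<Sum>i=1..n. s i)))"
proof -
  have "mset_gf q m (alternating_sum t (word_sum t)) $ n =
      (\<Sum>s\<in>decr_funs m n. q ^ (\<Sum>i=1..n. s i) * alternating_sum t (word_sum t) (image_mset s (mset_set {1..n})))"
    by (simp add: mset_gf_def sum_msets_conv_decr_funs)
  also have "\<dots> = (\<Sum>s\<in>decr_funs m n. q ^ (\<Sum>i=1..n. s i) * (\<Sum>\<sigma>\<in>compatible_perms n s. t ^ exc n \<sigma>))"
    by (intro sum.cong refl) (simp only: sum_exc_words[symmetric] sum_compatible_perms decr_funs_def mem_Collect_eq)
  also have "\<dots> = (\<Sum>s\<in>decr_funs m n. \<Sum>\<sigma> | \<sigma> permutes {1..n}.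
      if \<forall>i\<in>DEX n \<sigma>. s i \<noteq> s (i + 1) then t ^ exc n \<sigma> * q ^ (\<Sum>i=1..n. s i) else 0)"
    by (intro sum.cong refl) (auto simp: compatible_perms_def sum_distrib_left finite_permutations
        mult.commute simp flip: sum.inter_filter)
  also have "\<dots> = (\<Sum>\<sigma> | \<sigma> permutes {1..n}. \<Sum>s\<in>decr_funs m n.
      if \<forall>i\<in>DEX n \<sigma>. s i \<noteq> s (i + 1) then t ^ exc n \<sigma> * q ^ (\<Sum>i=1..n. s i) else 0)"
    by (rule sum.swap)
  also have "\<dots> = (\<Sum>\<sigma> | \<sigma> permutes {1..n}. t ^ exc n \<sigma> *
       (\<Sum>s | s \<in> decr_funs m n \<and> (\<forall>i\<in>DEX n \<sigma>. s i \<noteq> s (i + 1)). q ^ (\<Sum>i=1..n. s i)))"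
    by (intro sum.cong refl) (simp add: sum_distrib_left flip: sum.inter_filter)
  finally show ?thesis .
qed

text \<open>The choice \<open>a = t * q\<close> supplies the factor
  \<open>q ^ exc n \<sigma>\<close> that completes \<open>q ^ \<Sum>(DEX n \<sigma>)\<close> to
  \<open>q ^ maj n \<sigma>\<close>.\<close>

lemma A_maj_exc_tendsto:
  fixes q t :: real
  assumes q: "0 < q" "q < 1"
  shows "(\<lambda>m. mset_gf q m (alternating_sum (t * q) (word_sum (t * q))) $ n) \<longlonglongrightarrow>
    A_maj_exc n q t / (\<Prod>i=1..n. 1 - q ^ i)"
proof -
  let ?L = "1 / (\<Prod>i=1..n. 1 - q ^ i)"
  define S where "S \<sigma> m = (\<Sum>s | s \<in> decr_funs m n \<and> (\<forall>i\<in>DEX n \<sigma>. s i \<noteq> s (i + 1)). q ^ (\<Sum>i=1..n. s i))" for \<sigma> m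
  have "S \<sigma> \<longlonglongrightarrow> q ^ \<Sum>(DEX n \<sigma>) * ?L" for \<sigma>
  \<comment> \<open>The shift by \<open>card (DEX n \<sigma>)\<close> depends on
    \<open>\<sigma>\<close> but not on \<open>m\<close>, so it disappears in the limit.\<close>
  proof (rule LIMSEQ_offset)
    have "DEX n \<sigma> \<subseteq> {1..n-1}" by (auto simp: DEX_def)
    then have "S \<sigma> (m + card (DEX n \<sigma>)) = q ^ \<Sum>(DEX n \<sigma>) * complete_sum q m n" for m
      unfolding S_def by (rule sum_strictly_decr_funs)
    then show "(\<lambda>m. S \<sigma> (m + card (DEX n \<sigma>))) \<longlonglongrightarrow> q ^ \<Sum>(DEX n \<sigma>) * ?L"
      using complete_sum_tendsto[OF q] by (simp only:) (intro tendsto_mult tendsto_const)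
  qed
  then have "(\<lambda>m. mset_gf q m (alternating_sum (t * q) (word_sum (t * q))) $ n) \<longlonglongrightarrow>
      (\<Sum>\<sigma> | \<sigma> permutes {1..n}. (t * q) ^ exc n \<sigma> * (q ^ \<Sum>(DEX n \<sigma>) * ?L))"
    unfolding mset_gf_alternating_word_sum_nth S_def[symmetric]
    by (intro tendsto_sum tendsto_mult tendsto_const)
  also have "(\<Sum>\<sigma> | \<sigma> permutes {1..n}. (t * q) ^ exc n \<sigma> * (q ^ \<Sum>(DEX n \<sigma>) * ?L)) =
      (\<Sum>\<sigma> | \<sigma> permutes {1..n}. q ^ maj n \<sigma> * t ^ exc n \<sigma> * ?L)"
  proof (rule sum.cong[OF refl])
    fix \<sigma> assume "\<sigma> \<in> {\<sigma>. \<sigma> permutes {1..n}}"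
    then have "maj n \<sigma> = \<Sum>(DEX n \<sigma>) + exc n \<sigma>" by (simp add: sum_DEX_plus_exc)
    then show "(t * q) ^ exc n \<sigma> * (q ^ \<Sum>(DEX n \<sigma>) * ?L) = q ^ maj n \<sigma> * t ^ exc n \<sigma> * ?L"
      by (simp add: power_add power_mult_distrib)
  qed
  also have "\<dots> = A_maj_exc n q t / (\<Prod>i=1..n. 1 - q ^ i)"
    \<comment> \<open>For \<open>n = 0\<close> the identity is the only permutation, and the sum is
      the separately defined value 1.\<close>
    by (cases "n = 0") (simp_all add: A_maj_exc_def sum_divide_distrib maj_def DES_def exc_def)
  finally show ?thesis .
qed

text \<open>The \<open>n\<close>-th coefficient of \<open>alternating_word_sum_gf\<close> is a
  finite convolution, so the limit is taken termwise on both sides.\<close>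

lemma A_maj_exc_convolution_real:
  fixes q t :: real
  assumes q: "0 < q" "q < 1"
  defines "D \<equiv> \<lambda>n. \<Prod>i=1..n. 1 - q ^ i"
  shows "(\<Sum>k=0..n. A_maj_exc k q t / D k * (((t * q) ^ (n - k) - t * q) / D (n - k))) = (1 - t * q) / D n"
proof -
  define a where "a = t * q"
  define p where "p m k = mset_gf q m (alternating_sum a (word_sum a)) $ k" for m k
  have p: "(\<lambda>m. p m k) \<longlonglongrightarrow> A_maj_exc k q t / D k" for k
    unfolding p_def a_def D_def using q by (rule A_maj_exc_tendsto)
  have h: "(\<lambda>m. complete_sum q m k) \<longlonglongrightarrow> 1 / D k" for k
    unfolding D_def using q by (rule complete_sum_tendsto)
  have eq: "(\<Sum>k=0..n. p m k * ((a ^ (n - k) - a) * complete_sum q m (n - k))) = (1 - a) * complete_sum q m n" for m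
    using arg_cong[OF alternating_word_sum_gf[of q m a], of "\<lambda>f. f $ n"]
    by (simp add: fps_mult_nth[of "mset_gf q m (alternating_sum a (word_sum a))"] p_def complete_fps_def left_diff_distrib)
  have "(\<lambda>m. \<Sum>k=0..n. p m k * ((a ^ (n - k) - a) * complete_sum q m (n - k))) \<longlonglongrightarrow>
      (\<Sum>k=0..n. A_maj_exc k q t / D k * ((a ^ (n - k) - a) * (1 / D (n - k))))"
    by (intro tendsto_sum tendsto_mult tendsto_const p h)
  moreover have "(\<lambda>m. (1 - a) * complete_sum q m n) \<longlonglongrightarrow> (1 - a) * (1 / D n)"
    by (intro tendsto_mult tendsto_const h)
  ultimately have "(\<Sum>k=0..n. A_maj_exc k q t / D k * ((a ^ (n - k) - a) * (1 / D (n - k)))) = (1 - a) * (1 / D n)"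
    unfolding eq using LIMSEQ_unique by blast
  then show ?thesis by (simp add: a_def)
qed

section \<open>Transfer to rational functions\<close>

lemma q_int_times_one_minus: "q_int q n * (1 - q) = 1 - q ^ n"
  by (simp add: q_int_def one_diff_power_eq mult.commute)

lemma q_fact_times_power: "q_fact q n * (1 - q) ^ n = (\<Prod>i=1..n. 1 - q ^ i)"
proof -
  have "(1 - q) ^ n = (\<Prod>i=1..n. 1 - q)" by simp
  then show ?thesis unfolding q_fact_def by (simp only: prod.distrib[symmetric] q_int_times_one_minus)
qed

text \<open>Passing to q-factorials multiplies every term by the same power,
  \<open>(1 - q) ^ k * (1 - q) ^ (n - k) = (1 - q) ^ n\<close>.\<close>

lemma A_maj_exc_q_fact_convolution_real:
  fixes q t :: real
  assumes q: "0 < q" "q < 1"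
  shows "(\<Sum>k=0..n. A_maj_exc k q t / q_fact q k * (((t * q) ^ (n - k) - t * q) / q_fact q (n - k)))
    = (1 - t * q) / q_fact q n"
proof -
  define r where "r = 1 - q"
  have r: "r \<noteq> 0" using q by (simp add: r_def)
  have D: "(\<Prod>i=1..k. 1 - q ^ i) = q_fact q k * r ^ k" for k
    by (simp add: q_fact_times_power r_def)
  have "(\<Sum>k=0..n. A_maj_exc k q t / q_fact q k * (((t * q) ^ (n - k) - t * q) / q_fact q (n - k))) =
     (\<Sum>k=0..n. r ^ n * (A_maj_exc k q t / (q_fact q k * r ^ k) *
        (((t * q) ^ (n - k) - t * q) / (q_fact q (n - k) * r ^ (n - k)))))"
  proof (rule sum.cong[OF refl])
    fix k assume "k \<in> {0..n}"
    then have "r ^ n = r ^ k * r ^ (n - k)" by (simp flip: power_add)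
    then show "A_maj_exc k q t / q_fact q k * (((t * q) ^ (n - k) - t * q) / q_fact q (n - k)) =
      r ^ n * (A_maj_exc k q t / (q_fact q k * r ^ k) *
        (((t * q) ^ (n - k) - t * q) / (q_fact q (n - k) * r ^ (n - k))))"
      using r by simp
  qed
  also have "\<dots> = r ^ n * ((1 - t * q) / (q_fact q n * r ^ n))"
    using A_maj_exc_convolution_real[OF q, where n = n and t = t] unfolding D sum_distrib_left[symmetric] by simp
  finally show ?thesis using r by simp
qed

text \<open>The identity of coefficients with denominators cleared, so that it makes sense in every
  commutative ring and can be tested at rational points.\<close>

definition cleared_convolution :: "nat \<Rightarrow> 'a::comm_ring_1 \<Rightarrow> 'a \<Rightarrow> 'a" where
  "cleared_convolution n q t =
    (\<Sum>k=0..n. A_maj_exc k q t * ((t * q) ^ (n - k) - t * q) *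
       (\<Prod>j\<in>{0..n} - {k}. q_fact q j * q_fact q (n - j)))
    - (1 - t * q) * (\<Prod>j\<in>{0..n} - {n}. q_fact q j * q_fact q (n - j))"

lemma cleared_convolution_eq_0_iff:
  fixes q t :: "'a::field"
  assumes nz: "\<And>k. q_fact q k \<noteq> 0"
  shows "cleared_convolution n q t = 0 \<longleftrightarrow>
    (\<Sum>k=0..n. A_maj_exc k q t / q_fact q k * (((t * q) ^ (n - k) - t * q) / q_fact q (n - k)))
      = (1 - t * q) / q_fact q n"
proof -
  define G where "G j = q_fact q j * q_fact q (n - j)" for j
  \<comment> \<open>The common denominator; \<open>G n\<close> reduces to \<open>q_fact q n\<close>
    since \<open>q_fact q 0 = 1\<close>.\<close>
  define P where "P = (\<Prod>j=0..n. G j)"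
  have G: "G j \<noteq> 0" for j using nz by (simp add: G_def)
  have P0: "P \<noteq> 0" using G by (simp add: P_def)
  have P: "(\<Prod>j\<in>{0..n} - {k}. G j) = P / G k" if "k \<le> n" for k
    using that G prod.remove[of "{0..n}" k G] by (simp add: P_def)
  have "cleared_convolution n q t =
      (\<Sum>k=0..n. A_maj_exc k q t * ((t * q) ^ (n - k) - t * q) * (P / G k)) - (1 - t * q) * (P / G n)"
    unfolding cleared_convolution_def G_def[symmetric] by (simp add: P)
  also have "\<dots> = P * ((\<Sum>k=0..n. A_maj_exc k q t / q_fact q k * (((t * q) ^ (n - k) - t * q) / q_fact q (n - k)))
      - (1 - t * q) / q_fact q n)"
  proof -
    have "(\<Sum>k=0..n. A_maj_exc k q t * ((t * q) ^ (n - k) - t * q) * (P / G k)) =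
        P * (\<Sum>k=0..n. A_maj_exc k q t / q_fact q k * (((t * q) ^ (n - k) - t * q) / q_fact q (n - k)))"
      unfolding sum_distrib_left by (rule sum.cong) (simp_all add: G_def mult_ac)
    moreover have "(1 - t * q) * (P / G n) = P * ((1 - t * q) / q_fact q n)"
      by (simp add: G_def q_fact_def[of q 0])
    ultimately show ?thesis by (simp only: right_diff_distrib)
  qed
  finally show ?thesis using P0 by simp
qed

section \<open>Ring homomorphisms and specialisation\<close>

locale ring_hom_1 =
  fixes \<phi> :: "'a::comm_ring_1 \<Rightarrow> 'b::comm_ring_1"
  assumes hom_add: "\<phi> (x + y) = \<phi> x + \<phi> y"
    and hom_mult: "\<phi> (x * y) = \<phi> x * \<phi> y"
    and hom_1: "\<phi> 1 = 1"
begin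

lemma hom_0: "\<phi> 0 = 0"
  using hom_add[of 0 0] by simp

lemma hom_diff: "\<phi> (x - y) = \<phi> x - \<phi> y"
  using hom_add[of "x - y" y] by (simp add: algebra_simps)

lemma hom_sum: "\<phi> (sum f A) = (\<Sum>x\<in>A. \<phi> (f x))"
  by (induction A rule: infinite_finite_induct) (auto simp: hom_0 hom_add)

lemma hom_prod: "\<phi> (prod f A) = (\<Prod>x\<in>A. \<phi> (f x))"
  by (induction A rule: infinite_finite_induct) (auto simp: hom_1 hom_mult)

lemma hom_power: "\<phi> (x ^ n) = \<phi> x ^ n"
  by (induction n) (auto simp: hom_1 hom_mult)

lemma hom_q_int: "\<phi> (q_int q n) = q_int (\<phi> q) n"
  by (simp add: q_int_def hom_sum hom_power)

lemma hom_q_fact: "\<phi> (q_fact q n) = q_fact (\<phi> q) n"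
  by (simp add: q_fact_def hom_prod hom_q_int)

lemma hom_A_maj_exc: "\<phi> (A_maj_exc n q t) = A_maj_exc n (\<phi> q) (\<phi> t)"
  by (simp add: A_maj_exc_def hom_sum hom_mult hom_power hom_1)

lemma hom_cleared_convolution:
  "\<phi> (cleared_convolution n q t) = cleared_convolution n (\<phi> q) (\<phi> t)"
  by (simp add: cleared_convolution_def hom_diff hom_sum hom_prod hom_mult hom_power hom_1
      hom_A_maj_exc hom_q_fact)

end

lemma poly_eq_0_if_infinite_roots:
  fixes p :: "'a::idom poly"
  assumes "infinite X" "\<And>x. x \<in> X \<Longrightarrow> poly p x = 0"
  shows "p = 0"
  using assms poly_roots_finite[of p] finite_subset[of X "{x. poly p x = 0}"] by blast

interpretation to_fract: ring_hom_1 to_fract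
  by unfold_locales simp_all

interpretation eval2: ring_hom_1 "\<lambda>p :: 'a::comm_ring_1 poly poly. poly (poly p [:t:]) q" for q t
  by unfold_locales simp_all

interpretation of_rat: ring_hom_1 "of_rat :: rat \<Rightarrow> real"
  by unfold_locales (simp_all add: of_rat_add of_rat_mult)

text \<open>The identity is known for real \<open>0 < q < 1\<close>, hence at rational
  \<open>q\<close> there and every rational \<open>t\<close>. As a polynomial in the outer variable
  it has the infinitely many roots \<open>[:t:]\<close>, because each value is a polynomial in
  \<open>q\<close> with infinitely many roots.\<close>

lemma cleared_convolution_poly:
  "cleared_convolution n [:[:0, 1:]:] [:0, 1:] = (0 :: rat poly poly)"
proof (rule poly_eq_0_if_infinite_roots)
  show "infinite (range (\<lambda>t::rat. [:t:]))"
    by (subst finite_image_iff) (auto intro: injI simp: infinite_UNIV_char_0)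
  fix x :: "rat poly" assume "x \<in> range (\<lambda>t. [:t:])"
  then obtain t where x: "x = [:t:]" by blast
  show "poly (cleared_convolution n [:[:0, 1:]:] [:0, 1:]) x = 0"
    unfolding x
  proof (rule poly_eq_0_if_infinite_roots)
    show "infinite {0<..<1::rat}" by (simp add: infinite_Ioo)
    fix q :: rat assume q: "q \<in> {0<..<1}"
    define q' where "q' = (of_rat q :: real)"
    have q': "0 < q'" "q' < 1" using q by (simp_all add: q'_def)
    have "q_int q' k \<noteq> 0" if "k \<ge> 1" for k
    proof -
      have "(\<Sum>i<k. q' ^ i) > 0" using q' that by (intro sum_pos) (auto simp: lessThan_empty_iff)
      then show ?thesis by (simp add: q_int_def)
    qed
    then have "q_fact q' k \<noteq> 0" for k by (simp add: q_fact_def)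
    then have "cleared_convolution n q' (of_rat t) = 0"
      using A_maj_exc_q_fact_convolution_real[OF q'] by (subst cleared_convolution_eq_0_iff)
    then have "cleared_convolution n q t = 0"
      unfolding q'_def of_rat.hom_cleared_convolution[symmetric] by simp
    then show "poly (poly (cleared_convolution n [:[:0, 1:]:] [:0, 1:]) [:t:]) q = 0"
      by (simp add: eval2.hom_cleared_convolution)
  qed
qed

text \<open>At \<open>q = 1\<close> it specialises to the ordinary factorial.\<close>

lemma q_fact_q_var_nonzero: "q_fact q_var n \<noteq> 0"
proof -
  have "poly (poly (q_fact [:[:0, 1:]:] n) [:0:]) 1 = (q_fact 1 n :: rat)"
    by (rule eval2.hom_q_fact[THEN trans]) simp
  also have "\<dots> \<noteq> 0" by (simp add: q_fact_def q_int_def)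
  finally have "q_fact [:[:0, 1:]:] n \<noteq> (0 :: rat poly poly)" by auto
  then show ?thesis unfolding q_var_def to_fract.hom_q_fact[symmetric] by simp
qed

lemma t_q_var_neq_1: "1 - t_var * q_var \<noteq> 0"
proof -
  have "poly (poly (1 - [:0, 1:] * [:[:0, 1:]:]) [:0:]) 0 = (1 :: rat)" by simp
  then have "1 - [:0, 1:] * [:[:0, 1:]:] \<noteq> (0 :: rat poly poly)" by (metis poly_0 zero_neq_one)
  then have "to_fract (1 - [:0, 1:] * [:[:0, 1:]:] :: rat poly poly) \<noteq> 0" by (subst to_fract_eq_0_iff)
  then show ?thesis unfolding t_var_def q_var_def to_fract.hom_diff to_fract.hom_mult to_fract.hom_1 .
qed

theorem theorem1p1:
  shows "Abs_fps (\<lambda>n. A_maj_exc n q_var t_var / q_fact q_var n) =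
      (fps_const (1 - t_var * q_var) * q_exp q_var) /
      (fps_compose (q_exp q_var) (fps_const (t_var * q_var) * fps_X)
        - fps_const (t_var * q_var) * q_exp q_var)"
proof -
  define A where "A = Abs_fps (\<lambda>n. A_maj_exc n q_var t_var / q_fact q_var n)"
  define B where "B = fps_compose (q_exp q_var) (fps_const (t_var * q_var) * fps_X)
        - fps_const (t_var * q_var) * q_exp q_var"
  have B: "B $ k = ((t_var * q_var) ^ k - t_var * q_var) / q_fact q_var k" for k
    by (simp add: B_def q_exp_def fps_compose_linear diff_divide_distrib)
  have "A * B = fps_const (1 - t_var * q_var) * q_exp q_var"
  proof (rule fps_ext)
    fix n
    have "cleared_convolution n q_var t_var = 0"
      unfolding q_var_def t_var_def to_fract.hom_cleared_convolution[symmetric] cleared_convolution_poly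
      by simp
    then show "(A * B) $ n = (fps_const (1 - t_var * q_var) * q_exp q_var) $ n"
      unfolding cleared_convolution_eq_0_iff[OF q_fact_q_var_nonzero] fps_mult_nth[of A B] B
      by (simp add: A_def q_exp_def)
  qed
  \<comment> \<open>The constant term of \<open>B\<close> is \<open>1 - t_var * q_var\<close>, so
    dividing by \<open>B\<close> is legitimate.\<close>
  moreover have "B \<noteq> 0"
  proof -
    have "B $ 0 \<noteq> 0" using t_q_var_neq_1 by (simp add: B q_fact_def)
    then show ?thesis by auto
  qed
  ultimately have "A = fps_const (1 - t_var * q_var) * q_exp q_var / B"
    by (metis nonzero_mult_div_cancel_right)
  then show ?thesis unfolding A_def B_def .
qed

end
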